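(* Let $\mathcal{P}_3(z)=\sum_{n\ge 0} |\mathcal{S}_n\cap Av(\mathbf{4123},\mathbf{1342})|\, z^n$ be the generating function for the permutation class $Av(\mathbf{4123},\mathbf{1342})$. Then $$\mathcal{P}_3(z) = 1+ \frac{z(1-z)(1-2z)\left(1-7z+17z^2-16z^3+4z^4+(1-3z+3z^2)\sqrt{1-4z}\right)}{2-22z+96z^2-220z^3+282z^4-196z^5+64z^6-8z^7}.$$
   Context: A permutation $\sigma$ contains a pattern $\pi$ if some subsequence of $\sigma$ is order-isomorphic to $\pi$; otherwise $\sigma$ avoids $\pi$. For a set $B$ of patterns, $Av(B)$ is the set of permutations avoiding every element of $B$, and $\mathcal{S}_n$ is the set of permutations of length $n$ (the empty permutation is counted for $n=0$). *)

theory Defs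
  imports
    Complex_Main
    "HOL-Library.Sublist"
    "HOL-Combinatorics.Multiset_Permutations"
    "HOL-Computational_Algebra.Formal_Power_Series"
begin

text \<open>
  A permutation of length \<open>n\<close> is represented in one-line notation, as the list of its
  values: a list enumerating \<open>{1..n}\<close> without repetition.
\<close>

definition perms :: "nat \<Rightarrow> nat list set" where
  "perms n = permutations_of_set {1..n}"

definition order_isomorphic :: "nat list \<Rightarrow> nat list \<Rightarrow> bool" where
  "order_isomorphic xs ys \<longleftrightarrow>
     length xs = length ys \<and>
     (\<forall>i<length xs. \<forall>j<length xs. xs ! i < xs ! j \<longleftrightarrow> ys ! i < ys ! j)"

text \<open>The library relation \<open>subseq\<close> is that of not necessarily contiguous subsequences.\<close>

definition contains_pattern :: "nat list \<Rightarrow> nat list \<Rightarrow> bool" where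
  "contains_pattern \<sigma> \<pi> \<longleftrightarrow> (\<exists>\<tau>. subseq \<tau> \<sigma> \<and> order_isomorphic \<tau> \<pi>)"

definition Av :: "nat list set \<Rightarrow> nat list set" where
  "Av B = {\<sigma> \<in> (\<Union>n. perms n). \<forall>\<pi>\<in>B. \<not> contains_pattern \<sigma> \<pi>}"

definition class_gf :: "nat list set \<Rightarrow> real fps" where
  "class_gf C = Abs_fps (\<lambda>n. real (card (perms n \<inter> C)))"

definition P3 :: "real fps" where
  "P3 = class_gf (Av {[4,1,2,3], [1,3,4,2]})"

text \<open>
  The square root of a power series with positive constant coefficient, namely the one
  whose constant coefficient is the positive real square root.
\<close>

definition fps_sqrt :: "real fps \<Rightarrow> real fps" where
  "fps_sqrt f = fps_radical root 2 f"

end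

theory Submission
  imports Defs
begin

text \<open>
  Let \<open>M\<close> be the maximum of a permutation \<open>L M R\<close> of the class. Avoiding 4123 forces \<open>R\<close> to
  avoid 123; avoiding 1342 forces the letters of \<open>L\<close> lying in different gaps between the values
  of \<open>R\<close> to appear in decreasing order. With 4123 this gives \<open>L = B D\<close>, where the values of \<open>B\<close>
  form an interval \<open>{p<..p+m}\<close> and \<open>D\<close> is a decreasing sequence below \<open>p\<close>. The block \<open>B\<close> is an
  arbitrary member of the class, and the conditions on \<open>D\<close> and \<open>R\<close> do not depend on it. Hence the
  series \<open>P\<close> of the nonempty members satisfies \<open>P = z (C + P G)\<close>, where \<open>C\<close> is the Catalan series
  and \<open>G\<close> counts the possible pairs \<open>(D, R)\<close>. Removing first letters one at a time expresses
  \<open>G\<close> through powers of \<open>C\<close>.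
\<close>

subsection \<open>Pattern avoidance by removing the first letter\<close>

text \<open>If d precedes b in L and a value r of R lies between them, d < r < b, then d b M r is a
  copy of 1342. An ascent among the letters of L below p would, between the largest letter of L and
  p, give a copy of 4123; so only the topmost occupied gap can hold an arbitrary word. No letter
  outside B has a value inside its interval, so B acts on D and R like a single letter. Powers of C
  arise because the state after a first letter is a threshold: letters above it are high and must
  decrease, the others are low. The coefficient of z^l in C^(h+1) counts the 123-avoiding
  arrangements of l low and h high letters, and C^(n+1) = C^n + z C^(n+2) is the split by the first
  letter: the largest high letter, or some low one. Counting (D, R) adds a second threshold for D
  and a separate count for the 231 condition.\<close>

abbreviation dec :: "nat list \<Rightarrow> bool" where
  "dec \<equiv> sorted_wrt (\<ge>)"

fun av123 :: "nat list \<Rightarrow> bool" where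
  "av123 [] \<longleftrightarrow> True"
| "av123 (x # xs) \<longleftrightarrow> av123 xs \<and> dec (filter (\<lambda>y. x < y) xs)"

text \<open>No 231 in which \<open>x\<close>, placed in front, plays the 2.\<close>

fun no_drop :: "nat \<Rightarrow> nat list \<Rightarrow> bool" where
  "no_drop x [] \<longleftrightarrow> True"
| "no_drop x (y # ys) \<longleftrightarrow> no_drop x ys \<and> (x < y \<longrightarrow> (\<forall>z\<in>set ys. \<not> z < x))"

fun av231 :: "nat list \<Rightarrow> bool" where
  "av231 [] \<longleftrightarrow> True"
| "av231 (x # xs) \<longleftrightarrow> av231 xs \<and> no_drop x xs"

text \<open>A new first letter can only be the 4 of 4123 or the 1 of 1342. The other three letters
  then form 123 below it, or 342, which is a 231, above it.\<close>

fun av_both :: "nat list \<Rightarrow> bool" where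
  "av_both [] \<longleftrightarrow> True"
| "av_both (x # xs) \<longleftrightarrow>
     av_both xs \<and> av123 (filter (\<lambda>y. y < x) xs) \<and> av231 (filter (\<lambda>y. x < y) xs)"

lemma subseq_filter_iff:
  "subseq ys (filter P xs) \<longleftrightarrow> subseq ys xs \<and> (\<forall>y\<in>set ys. P y)"
proof
  assume *: "subseq ys (filter P xs)"
  then have "P y" if "y \<in> set ys" for y
    using that by (elim list_emb_set) auto
  moreover have "subseq ys xs"
    using * subseq_filter_left by (rule subseq_order.order_trans)
  ultimately show "subseq ys xs \<and> (\<forall>y\<in>set ys. P y)" by blast
next
  assume *: "subseq ys xs \<and> (\<forall>y\<in>set ys. P y)"
  then have "subseq (filter P ys) (filter P xs)" by (intro subseq_filter) simp
  with * show "subseq ys (filter P xs)" by (simp add: filter_id_conv[THEN iffD2])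
qed

lemma subseq_Cons_Cons_iff:
  "subseq (a # as) (x # xs) \<longleftrightarrow> a = x \<and> subseq as xs \<or> subseq (a # as) xs"
  using subseq_Cons2_iff[of a as x xs] list_emb_Cons[of "(=)" "a # as" xs x]
    subseq_Cons'[of a as xs] by (auto split: if_splits)

lemma dec_iff_subseq: "dec xs \<longleftrightarrow> (\<forall>a b. subseq [a, b] xs \<longrightarrow> \<not> a < b)"
proof (induction xs)
  case (Cons x xs)
  show ?case
    unfolding sorted_wrt.simps Cons.IH subseq_Cons_Cons_iff subseq_singleton_left not_less by blast
qed simp

lemma av123_iff_subseq:
  "av123 xs \<longleftrightarrow> (\<forall>a b c. subseq [a, b, c] xs \<longrightarrow> \<not> (a < b \<and> b < c))"
proof (induction xs)
  case (Cons x xs)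
  have "dec (filter (\<lambda>y. x < y) xs) \<longleftrightarrow> (\<forall>b c. subseq [b, c] xs \<longrightarrow> \<not> (x < b \<and> b < c))"
    unfolding dec_iff_subseq subseq_filter_iff by (intro iff_allI) auto
  then show ?case
    unfolding av123.simps Cons.IH subseq_Cons_Cons_iff[of _ "[_, _]"] by blast
qed simp

lemma no_drop_iff_subseq:
  "no_drop x xs \<longleftrightarrow> (\<forall>b c. subseq [b, c] xs \<longrightarrow> \<not> (c < x \<and> x < b))"
proof (induction xs)
  case (Cons y ys)
  show ?case
    unfolding no_drop.simps Cons.IH subseq_Cons_Cons_iff subseq_singleton_left by blast
qed simp

lemma av231_iff_subseq:
  "av231 xs \<longleftrightarrow> (\<forall>a b c. subseq [a, b, c] xs \<longrightarrow> \<not> (c < a \<and> a < b))"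
proof (induction xs)
  case (Cons x xs)
  show ?case
    unfolding av231.simps Cons.IH no_drop_iff_subseq subseq_Cons_Cons_iff by blast
qed simp

lemma av_both_iff_subseq:
  "av_both xs \<longleftrightarrow>
     (\<forall>a b c d. subseq [a, b, c, d] xs \<longrightarrow>
        \<not> (b < c \<and> c < d \<and> d < a) \<and> \<not> (a < d \<and> d < b \<and> b < c))"
proof (induction xs)
  case (Cons x xs)
  have "av123 (filter (\<lambda>y. y < x) xs) \<longleftrightarrow>
          (\<forall>b c d. subseq [b, c, d] xs \<longrightarrow> \<not> (b < c \<and> c < d \<and> d < x))"
    unfolding av123_iff_subseq subseq_filter_iff by (intro iff_allI) auto
  moreover have "av231 (filter (\<lambda>y. x < y) xs) \<longleftrightarrow>
          (\<forall>b c d. subseq [b, c, d] xs \<longrightarrow> \<not> (x < d \<and> d < b \<and> b < c))"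
    unfolding av231_iff_subseq subseq_filter_iff by (intro iff_allI) auto
  ultimately show ?case
    unfolding av_both.simps Cons.IH subseq_Cons_Cons_iff[of _ "[_, _, _]"] by blast
qed simp

lemma order_isomorphic_4:
  "order_isomorphic xs [p, q, r, s] \<longleftrightarrow>
     (\<exists>a b c d. xs = [a, b, c, d] \<and> order_isomorphic [a, b, c, d] [p, q, r, s])"
proof
  assume "order_isomorphic xs [p, q, r, s]"
  moreover from this have "length xs = Suc (Suc (Suc (Suc 0)))"
    by (simp add: order_isomorphic_def)
  then obtain a b c d where "xs = [a, b, c, d]"
    unfolding length_Suc_conv by auto
  ultimately show "\<exists>a b c d. xs = [a, b, c, d] \<and> order_isomorphic [a, b, c, d] [p, q, r, s]"
    by blast
qed blast

lemma order_isomorphic_4123: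
  "order_isomorphic xs [4, 1, 2, 3] \<longleftrightarrow>
     (\<exists>a b c d. xs = [a, b, c, d] \<and> b < c \<and> c < d \<and> d < a)"
  by (subst order_isomorphic_4)
     (auto simp: order_isomorphic_def All_less_Suc)

lemma order_isomorphic_1342:
  "order_isomorphic xs [1, 3, 4, 2] \<longleftrightarrow>
     (\<exists>a b c d. xs = [a, b, c, d] \<and> a < d \<and> d < b \<and> b < c)"
  by (subst order_isomorphic_4)
     (auto simp: order_isomorphic_def All_less_Suc)

lemma perms_Int_Av:
  "perms n \<inter> Av {[4, 1, 2, 3], [1, 3, 4, 2]} = {xs \<in> permutations_of_set {1..n}. av_both xs}"
proof -
  have "(\<forall>\<pi>\<in>{[4, 1, 2, 3], [1, 3, 4, 2]}. \<not> contains_pattern xs \<pi>) \<longleftrightarrow> av_both xs" for xs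
    unfolding contains_pattern_def av_both_iff_subseq ball_simps order_isomorphic_4123
      order_isomorphic_1342 by blast
  then show ?thesis by (auto simp: Av_def perms_def)
qed

lemma dec_filter: "dec xs \<Longrightarrow> dec (filter P xs)"
  by (rule sorted_wrt_filter)

lemma dec_filter_mono:
  assumes "dec (filter P xs)" "\<And>x. x \<in> set xs \<Longrightarrow> Q x \<Longrightarrow> P x"
  shows "dec (filter Q xs)"
proof -
  have "filter Q xs = filter Q (filter P xs)"
    using assms(2) by (auto intro!: filter_cong)
  then show ?thesis using dec_filter[OF assms(1)] by metis
qed

lemma av231_if_dec: "dec xs \<Longrightarrow> av231 xs"
  unfolding av231_iff_subseq dec_iff_subseq
  by (metis subseq_Cons' subseq_order.order_trans subseq_Cons2_iff list_emb_Nil)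

lemma av_both_shift: "av_both (map (\<lambda>x. x + k) xs) \<longleftrightarrow> av_both xs"
proof -
  have d: "dec (map (\<lambda>x. x + k) xs) \<longleftrightarrow> dec xs" for xs by (simp add: sorted_wrt_map)
  have a: "av123 (map (\<lambda>x. x + k) xs) \<longleftrightarrow> av123 xs" for xs
    by (induction xs) (simp_all add: filter_map comp_def d)
  have n: "no_drop (x + k) (map (\<lambda>x. x + k) xs) \<longleftrightarrow> no_drop x xs" for x xs
    by (induction xs) auto
  have b: "av231 (map (\<lambda>x. x + k) xs) \<longleftrightarrow> av231 xs" for xs
    by (induction xs) (simp_all add: n)
  show ?thesis
    by (induction xs) (simp_all add: filter_map comp_def a b)
qed

subsection \<open>Catalan series and 123-avoiding permutations\<close>

text \<open>The root (1 - sqrt(1 - 4z)) / (2z) of C = 1 + z C^2; the shift carries out the division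
  by z.\<close>

definition catalan_fps :: "real fps" where
  "catalan_fps = fps_shift 1 (fps_const (1 / 2) * (1 - fps_sqrt (1 - 4 * fps_X)))"

lemma fps_sqrt_power2: "fps_sqrt (1 - 4 * fps_X) ^ 2 = 1 - 4 * fps_X"
proof -
  have "fps_nth (1 - 4 * fps_X :: real fps) 0 = 1" by simp
  then show ?thesis
    using power_radical[of "1 - 4 * fps_X :: real fps" root 1]
    by (simp add: fps_sqrt_def numeral_2_eq_2)
qed

lemma fps_sqrt_eq_catalan: "fps_sqrt (1 - 4 * fps_X) = 1 - 2 * fps_X * catalan_fps"
proof -
  let ?h = "fps_const (1 / 2) * (1 - fps_sqrt (1 - 4 * fps_X))"
  have "fps_nth ?h 0 = 0" by (simp add: fps_sqrt_def)
  then have "fps_X * catalan_fps = ?h"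
    unfolding catalan_fps_def
    by (intro fps_ext) (auto simp: fps_X_mult_nth fps_eq_iff)
  then have "2 * (fps_X * catalan_fps) = (2 * fps_const (1 / 2)) * (1 - fps_sqrt (1 - 4 * fps_X))"
    by (simp only: mult.assoc)
  also have "2 * fps_const (1 / 2) = (1 :: real fps)"
    by (simp add: numeral_fps_const)
  finally show ?thesis by (simp add: algebra_simps)
qed

lemma catalan_fps_rec: "catalan_fps = 1 + fps_X * catalan_fps ^ 2"
proof -
  have "(1 - 2 * fps_X * catalan_fps) ^ 2 = 1 - 4 * fps_X"
    using fps_sqrt_power2 fps_sqrt_eq_catalan by simp
  then have "4 * fps_X * (catalan_fps - (1 + fps_X * catalan_fps ^ 2)) = 0"
    by (simp add: power2_eq_square algebra_simps)
  then show ?thesis by simp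
qed

lemma catalan_fps_power_Suc:
  "catalan_fps ^ Suc n = catalan_fps ^ n + fps_X * catalan_fps ^ (n + 2)"
proof -
  have "catalan_fps ^ Suc n = catalan_fps ^ n * (1 + fps_X * catalan_fps ^ 2)"
    using catalan_fps_rec by (metis power_Suc2)
  also have "\<dots> = catalan_fps ^ n + fps_X * catalan_fps ^ (n + 2)"
    by (simp add: algebra_simps power_add power2_eq_square)
  finally show ?thesis .
qed

lemma catalan_fps_nth_0: "fps_nth catalan_fps 0 = 1"
  by (subst catalan_fps_rec) simp

text \<open>A summation of ballot numbers along a diagonal. The last summand splits off, the rest is
  the same sum for \<open>Suc j\<close>, and C^(j+2) = C^(j+1) + z C^(j+3) joins the two. In the
  counts, \<open>i\<close> is the rank of a low first letter.\<close>

lemma sum_catalan_fps_powers: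
  "(\<Sum>i<l. fps_nth (catalan_fps ^ (l + j - i)) i) = fps_nth (fps_X * catalan_fps ^ (j + 2)) l"
proof (cases l)
  case (Suc k)
  have "(\<Sum>i<Suc k. fps_nth (catalan_fps ^ Suc (k + j - i)) i) = fps_nth (catalan_fps ^ (j + 2)) k"
  proof (induction k arbitrary: j)
    case 0
    then show ?case by (simp add: fps_nth_power_0 catalan_fps_nth_0)
  next
    case (Suc k)
    have "(\<Sum>i<Suc (Suc k). fps_nth (catalan_fps ^ Suc (Suc k + j - i)) i) =
            fps_nth (catalan_fps ^ Suc j) (Suc k) + fps_nth (catalan_fps ^ (j + 3)) k"
      using Suc.IH[of "Suc j"] by (simp add: eval_nat_numeral)
    also have "\<dots> = fps_nth (catalan_fps ^ Suc (Suc j)) (Suc k)"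
      by (subst (2) catalan_fps_power_Suc) (simp add: eval_nat_numeral)
    finally show ?case by simp
  qed
  moreover have "Suc k + j - i = Suc (k + j - i)" if "i < Suc k" for i
    using that by simp
  ultimately show ?thesis using Suc by simp
qed simp

section \<open>Counting arrangements of a finite set by their first letter\<close>

definition count_perms :: "(nat list \<Rightarrow> bool) \<Rightarrow> nat set \<Rightarrow> nat" where
  "count_perms P S = card {xs \<in> permutations_of_set S. P xs}"

lemma count_perms_cong:
  "(\<And>xs. set xs = S \<Longrightarrow> distinct xs \<Longrightarrow> P xs = Q xs) \<Longrightarrow> count_perms P S = count_perms Q S"
  unfolding count_perms_def
  by (intro arg_cong[where f = card]) (auto dest: permutations_of_setD)

lemma count_perms_eq_0:
  "(\<And>xs. set xs = S \<Longrightarrow> distinct xs \<Longrightarrow> \<not> P xs) \<Longrightarrow> count_perms P S = 0"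
  unfolding count_perms_def by (auto dest: permutations_of_setD)

lemma count_perms_empty: "count_perms P {} = (if P [] then 1 else 0)"
  by (simp add: count_perms_def Collect_conv_if)

lemma count_perms_rec:
  assumes "finite S" "S \<noteq> {}"
  shows "count_perms P S = (\<Sum>x\<in>S. count_perms (\<lambda>xs. P (x # xs)) (S - {x}))"
proof -
  let ?A = "\<lambda>x. {xs \<in> permutations_of_set (S - {x}). P (x # xs)}"
  have "{xs \<in> permutations_of_set S. P xs} = (\<Union>x\<in>S. (#) x ` ?A x)"
    using assms(2) by (auto simp: permutations_of_set_nonempty)
  then have "count_perms P S = (\<Sum>x\<in>S. card ((#) x ` ?A x))"
    unfolding count_perms_def using assms(1) by (subst card_UN_disjoint[symmetric]) auto
  then show ?thesis by (simp add: count_perms_def card_image)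
qed

lemma count_perms_single_head:
  assumes "finite S" "x \<in> S"
    and "\<And>y xs. y \<in> S \<Longrightarrow> y \<noteq> x \<Longrightarrow> set xs = S - {y} \<Longrightarrow> \<not> P (y # xs)"
  shows "count_perms P S = count_perms (\<lambda>xs. P (x # xs)) (S - {x})"
proof -
  have "count_perms (\<lambda>xs. P (y # xs)) (S - {y}) = 0" if "y \<in> S - {x}" for y
    using that assms(3) by (intro count_perms_eq_0) auto
  then show ?thesis
    using assms(1,2) by (subst count_perms_rec) (auto simp: sum.remove[of S x])
qed

lemma sum_rank_below:
  fixes S :: "'a :: linorder set" and f :: "nat \<Rightarrow> 'b :: comm_monoid_add"
  assumes "finite S"
  shows "(\<Sum>x\<in>S. f (card {y \<in> S. y < x})) = (\<Sum>i<card S. f i)"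
  using assms
proof (induction rule: finite_linorder_max_induct)
  case (insert b A)
  have "{y \<in> insert b A. y < b} = A" "b \<notin> A" using insert by auto
  moreover have "{y \<in> insert b A. y < x} = {y \<in> A. y < x}" if "x \<in> A" for x
    using insert that by force
  ultimately show ?case using insert by (simp add: add.commute)
qed simp

lemma sum_rank_above:
  fixes S :: "'a :: linorder set" and f :: "nat \<Rightarrow> 'b :: comm_monoid_add"
  assumes "finite S"
  shows "(\<Sum>x\<in>S. f (card {y \<in> S. x < y})) = (\<Sum>i<card S. f i)"
  using assms
proof (induction rule: finite_linorder_min_induct)
  case (insert b A)
  have "{y \<in> insert b A. b < y} = A" "b \<notin> A" using insert by auto
  moreover have "{y \<in> insert b A. x < y} = {y \<in> A. x < y}" if "x \<in> A" for x
    using insert that by force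
  ultimately show ?case using insert by (simp add: add.commute)
qed simp

lemma card_le_gt_split:
  fixes S :: "nat set"
  assumes "finite S"
  shows "card {y \<in> S. y \<le> t} + card {y \<in> S. t < y} = card S"
proof -
  have "S = {y \<in> S. y \<le> t} \<union> {y \<in> S. t < y}" by auto
  then show ?thesis using assms by (subst (3) \<open>S = _\<close>, subst card_Un_disjoint) auto
qed

text \<open>A low first letter \<open>x\<close> becomes the new threshold, so every letter above it
  turns high. The letters above and below \<open>x\<close> together number one less than
  \<open>S\<close>; this ties the exponent to the rank of \<open>x\<close>, as the diagonal sum of
  ballot numbers requires.\<close>

lemma sum_low_heads:
  fixes S :: "nat set" and f :: "nat \<Rightarrow> real"
  assumes "finite S"
    and "\<And>x. x \<in> S \<Longrightarrow> x \<le> t \<Longrightarrow> f x = fps_nth (catalan_fps ^ Suc (card {y \<in> S. x < y})) (card {y \<in> S. y < x})"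
  shows "(\<Sum>x\<in>{y \<in> S. y \<le> t}. f x) =
    fps_nth (fps_X * catalan_fps ^ (card {y \<in> S. t < y} + 2)) (card {y \<in> S. y \<le> t})"
proof -
  let ?L = "{y \<in> S. y \<le> t}"
  have "f x = fps_nth (catalan_fps ^ (card ?L + card {y \<in> S. t < y} - card {y \<in> ?L. y < x}))
          (card {y \<in> ?L. y < x})" if x: "x \<in> ?L" for x
  proof -
    have 1: "{y \<in> ?L. y < x} = {y \<in> S. y < x}" using x by auto
    have "{y \<in> S. y \<le> x} = insert x {y \<in> S. y < x}" using x by auto
    then have "card {y \<in> S. y \<le> x} = Suc (card {y \<in> S. y < x})" using assms(1) by simp
    then have "card ?L + card {y \<in> S. t < y} - card {y \<in> S. y < x} = Suc (card {y \<in> S. x < y})"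
      using card_le_gt_split[OF assms(1), of t] card_le_gt_split[OF assms(1), of x] by linarith
    then show ?thesis using assms(2) x unfolding 1 by simp
  qed
  then show ?thesis
    using sum_rank_below[of ?L "\<lambda>i. fps_nth (catalan_fps ^ (card ?L + card {y \<in> S. t < y} - i)) i"]
      assms(1) by (simp add: sum_catalan_fps_powers)
qed

text \<open>The same condition as \<open>av123 (t # xs)\<close>, read with \<open>t\<close> as a
  threshold that may itself be a letter of \<open>xs\<close>.\<close>

definition av123_dec_above :: "nat \<Rightarrow> nat list \<Rightarrow> bool" where
  "av123_dec_above t xs \<longleftrightarrow> av123 xs \<and> dec (filter (\<lambda>y. t < y) xs)"

lemma dec_above_antimono: "dec (filter (\<lambda>y. x < y) xs) \<Longrightarrow> x \<le> t \<Longrightarrow> dec (filter (\<lambda>y. t < y) xs)"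
  by (erule dec_filter_mono) auto

lemma filter_removed:
  fixes x :: nat
  shows "{y \<in> S - {x}. y \<le> x} = {y \<in> S. y < x}" "{y \<in> S - {x}. x < y} = {y \<in> S. x < y}"
  by auto

text \<open>These are ballot numbers. A high first letter must be the largest one, and removing it
  lowers the exponent by one; a low first letter \<open>x\<close> replaces the threshold by
  \<open>x\<close>. The two contributions are the two terms of C^(h+1) = C^h + z C^(h+2).\<close>

lemma count_av123_dec_above:
  assumes "finite S"
  shows "real (count_perms (av123_dec_above t) S) =
    fps_nth (catalan_fps ^ Suc (card {y \<in> S. t < y})) (card {y \<in> S. y \<le> t})"
  using assms
proof (induction "card S" arbitrary: S t rule: less_induct)
  case less
  show ?case
  proof (cases "S = {}")
    case True
    then show ?thesis by (simp add: count_perms_empty av123_dec_above_def catalan_fps_nth_0)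
  next
    case False
    let ?L = "{y \<in> S. y \<le> t}" and ?H = "{y \<in> S. t < y}"
    let ?c = "\<lambda>x. real (count_perms (\<lambda>xs. av123_dec_above t (x # xs)) (S - {x}))"
    have IH: "real (count_perms (av123_dec_above t') (S - {x})) =
      fps_nth (catalan_fps ^ Suc (card {y \<in> S - {x}. t' < y})) (card {y \<in> S - {x}. y \<le> t'})"
      if "x \<in> S" for x t'
      using that less card_Diff1_less[of S x] by auto
    have "?c x = fps_nth (catalan_fps ^ Suc (card {y \<in> S. x < y})) (card {y \<in> S. y < x})"
      if "x \<in> S" "x \<le> t" for x
    proof -
      have "count_perms (\<lambda>xs. av123_dec_above t (x # xs)) (S - {x}) =
              count_perms (av123_dec_above x) (S - {x})"
        using that by (intro count_perms_cong) (auto simp: av123_dec_above_def intro: dec_above_antimono)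
      then show ?thesis using IH[of x x, unfolded filter_removed] that by simp
    qed
    then have L: "(\<Sum>x\<in>?L. ?c x) = fps_nth (fps_X * catalan_fps ^ (card ?H + 2)) (card ?L)"
      using less.prems by (rule sum_low_heads[rotated])
    have H: "(\<Sum>x\<in>?H. ?c x) = (if ?H = {} then 0 else fps_nth (catalan_fps ^ card ?H) (card ?L))"
    proof (cases "?H = {}")
      case nonempty: False
      define x where "x = Max ?H"
      have x: "x \<in> ?H" and max: "\<And>y. y \<in> ?H \<Longrightarrow> y \<le> x"
        using nonempty less.prems Max_in[of ?H] unfolding x_def by auto
      have "?c y = 0" if "y \<in> ?H - {x}" for y
      proof -
        have "\<not> av123_dec_above t (y # xs)" if "set xs = S - {y}" for xs
          using x max[of y] \<open>y \<in> ?H - {x}\<close> that by (auto simp: av123_dec_above_def)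
        then show ?thesis by (simp add: count_perms_eq_0)
      qed
      then have "(\<Sum>y\<in>?H. ?c y) = ?c x"
        using less.prems x by (subst sum.remove[of _ x]) auto
      also have "count_perms (\<lambda>xs. av123_dec_above t (x # xs)) (S - {x}) =
                   count_perms (av123_dec_above t) (S - {x})"
      proof (rule count_perms_cong)
        fix xs assume xs: "set xs = S - {x}"
        have "filter (\<lambda>y. x < y) xs = []" using max xs x by (force simp: filter_empty_conv)
        then show "av123_dec_above t (x # xs) = av123_dec_above t xs"
          using max xs x by (auto simp: av123_dec_above_def)
      qed
      also have "real \<dots> = fps_nth (catalan_fps ^ card ?H) (card ?L)"
      proof -
        have "{y \<in> S - {x}. t < y} = ?H - {x}" "{y \<in> S - {x}. y \<le> t} = ?L" using x by auto
        moreover have "Suc (card (?H - {x})) = card ?H"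
          using x less.prems by (intro card.remove[symmetric]) auto
        ultimately show ?thesis using IH[of x t] x by simp
      qed
      finally show ?thesis by (subst if_not_P[OF nonempty])
    next
      case True
      show ?thesis unfolding True by simp
    qed
    have "real (count_perms (av123_dec_above t) S) = (\<Sum>x\<in>S. ?c x)"
      using less.prems False by (simp add: count_perms_rec)
    also have "S = ?L \<union> ?H" by auto
    then have "(\<Sum>x\<in>S. ?c x) = (\<Sum>x\<in>?L. ?c x) + (\<Sum>x\<in>?H. ?c x)"
      using less.prems by (subst \<open>S = _\<close>, subst sum.union_disjoint) auto
    also have "\<dots> = fps_nth (catalan_fps ^ Suc (card ?H)) (card ?L)"
    proof (cases "?H = {}")
      case True
      then have "?L = S" by auto
      \<comment> \<open>Without high letters the term C^0 has to contribute nothing. It is the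
        constant 1, whose coefficient at \<open>card ?L > 0\<close> is 0.\<close>
      then have "?L \<noteq> {}" using False by simp
      then show ?thesis
        unfolding L H catalan_fps_power_Suc unfolding True using less.prems by simp
    next
      case False
      show ?thesis unfolding L H catalan_fps_power_Suc if_not_P[OF False] by simp
    qed
    finally show ?thesis .
  qed
qed

section \<open>The letters after a first letter subject to both 123 and 231\<close>

lemma no_drop_if_no_greater: "(\<And>y. y \<in> set ys \<Longrightarrow> \<not> x < y) \<Longrightarrow> no_drop x ys"
  by (induction ys) auto

lemma no_drop_if_no_less: "(\<And>y. y \<in> set ys \<Longrightarrow> \<not> y < x) \<Longrightarrow> no_drop x ys"
  by (induction ys) auto

lemma subseq_pairD: "subseq [a, b] xs \<Longrightarrow> \<exists>p q. xs = p @ b # q \<and> a \<in> set p"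
proof (induction xs)
  case (Cons x xs)
  from Cons.prems consider "a = x" "b \<in> set xs" | "subseq [a, b] xs"
    unfolding subseq_Cons_Cons_iff subseq_singleton_left by blast
  then show ?case
  proof cases
    case 1
    then obtain p q where "xs = p @ b # q" by (auto simp: in_set_conv_decomp)
    with 1 show ?thesis by (intro exI[of _ "x # p"] exI[of _ q]) simp
  next
    case 2
    then obtain p q where "xs = p @ b # q" "a \<in> set p" using Cons.IH by blast
    then show ?thesis by (intro exI[of _ "x # p"] exI[of _ q]) simp
  qed
qed simp

text \<open>Take an ascent \<open>a < b\<close> between \<open>s\<close> and \<open>x\<close>. If
  \<open>y\<close> comes before \<open>b\<close>, then \<open>y\<close>, \<open>b\<close> is a drop
  across \<open>x\<close>; if it comes after, \<open>a\<close>, \<open>b\<close>, \<open>y\<close>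
  is a 123.\<close>

lemma dec_between_if_no_drop:
  assumes "av123 xs" "no_drop x (filter (\<lambda>y. s < y) xs)" "y \<in> set xs" "x < y" "s < x"
  shows "dec (filter (\<lambda>z. s < z \<and> z < x) xs)"
  unfolding dec_iff_subseq
proof (intro allI impI notI)
  fix a b
  assume "subseq [a, b] (filter (\<lambda>z. s < z \<and> z < x) xs)" "a < b"
  then have ab: "subseq [a, b] xs" "s < a" "a < b" "b < x" by (auto simp: subseq_filter_iff)
  obtain p q where pq: "xs = p @ b # q" "a \<in> set p" using subseq_pairD[OF ab(1)] by blast
  have "y \<in> set p \<or> y \<in> set q" using assms(3,4) ab(4) pq(1) by auto
  then show False
  proof
    assume "y \<in> set p"
    then have "subseq [y] p" "subseq [b] (b # q)" by (simp_all add: subseq_singleton_left)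
    then have "subseq [y, b] xs" using list_emb_append_mono[of "(=)" "[y]" p "[b]"] pq by simp
    then have "subseq [y, b] (filter (\<lambda>y. s < y) xs)"
      using ab assms(4,5) by (simp add: subseq_filter_iff)
    then show False using assms(2,4) ab(4) unfolding no_drop_iff_subseq by blast
  next
    assume "y \<in> set q"
    then have "subseq [a] p" "subseq [b, y] (b # q)" using pq by (simp_all add: subseq_singleton_left)
    then have "subseq [a, b, y] xs" using list_emb_append_mono[of "(=)" "[a]" p "[b, y]"] pq by simp
    moreover have "b < y" using assms(4) ab(4) by simp
    ultimately show False using assms(1) ab(3) unfolding av123_iff_subseq by blast
  qed
qed

text \<open>The 2 and the 3 of a 231 form an ascent. As both parts decrease, the ascent must cross
  \<open>x\<close>; the later 1 then drops below \<open>x\<close>.\<close>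

lemma av231_if_dec_parts:
  assumes "dec (filter (\<lambda>y. y < x) ys)" "dec (filter (\<lambda>y. x < y) ys)" "no_drop x ys" "x \<notin> set ys"
  shows "av231 ys"
  unfolding av231_iff_subseq
proof (intro allI impI notI)
  fix a b c assume abc: "subseq [a, b, c] ys" and less: "c < a \<and> a < b"
  have "subseq [a, b] [a, b, c]" "subseq [b, c] [a, b, c]" by simp_all
  then have ab: "subseq [a, b] ys" and bc: "subseq [b, c] ys"
    using abc subseq_order.order_trans by blast+
  have "a \<in> set ys" using abc by (auto elim!: list_emb_set)
  then have "a \<noteq> x" using assms(4) by auto
  then consider "a < x" "x < b" | "b \<le> x" "a < x" | "x < a" by linarith
  then show False
  proof cases
    case 1
    moreover have "c < x" using 1 less by simp
    ultimately show ?thesis using assms(3) bc unfolding no_drop_iff_subseq by blast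
  next
    case 2
    have "b \<in> set ys" using subseq_pairD[OF ab] by auto
    then have "b < x" using 2 assms(4) by (metis le_neq_implies_less)
    then have "subseq [a, b] (filter (\<lambda>y. y < x) ys)" using 2 ab by (simp add: subseq_filter_iff)
    then show ?thesis using assms(1) less unfolding dec_iff_subseq by blast
  next
    case 3
    then have "subseq [a, b] (filter (\<lambda>y. x < y) ys)" using less ab by (simp add: subseq_filter_iff)
    then show ?thesis using assms(2) less unfolding dec_iff_subseq by blast
  qed
qed

text \<open>
  Given a first letter \<open>x > s\<close>, this describes what may follow it: the letters between \<open>s\<close>
  and \<open>x\<close> and those above \<open>x\<close> form two decreasing runs, the former preceding the latter.
\<close>

definition split_dec :: "nat \<Rightarrow> nat \<Rightarrow> nat list \<Rightarrow> bool" where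
  "split_dec s x xs \<longleftrightarrow> av123 xs \<and> dec (filter (\<lambda>y. x < y) xs) \<and>
     dec (filter (\<lambda>y. s < y \<and> y < x) xs) \<and> no_drop x (filter (\<lambda>y. s < y) xs)"

text \<open>As soon as some letter exceeds \<open>x\<close>, the letters between \<open>s\<close>
  and \<open>x\<close> are forced to come first, in decreasing order, so their number does not
  affect the count. If none exceeds \<open>x\<close>, only the threshold \<open>s\<close> is
  left.\<close>

lemma count_split_dec:
  assumes "finite S" "s < x" "x \<notin> S"
  shows "real (count_perms (split_dec s x) S) =
    (if {y \<in> S. x < y} = {}
     then fps_nth (catalan_fps ^ Suc (card {y \<in> S. s < y \<and> y < x})) (card {y \<in> S. y \<le> s})
     else fps_nth (catalan_fps ^ Suc (card {y \<in> S. x < y})) (card {y \<in> S. y \<le> s}))"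
proof (cases "{y \<in> S. x < y} = {}")
  case True
  then have less: "y < x" if "y \<in> S" for y using that assms(3) by (metis (mono_tags) empty_Collect_eq nat_neq_iff)
  have "split_dec s x xs \<longleftrightarrow> av123_dec_above s xs" if "set xs = S" for xs
  proof -
    have "filter (\<lambda>y. x < y) xs = []" using that less by (force simp: filter_empty_conv)
    moreover have "filter (\<lambda>y. s < y \<and> y < x) xs = filter (\<lambda>y. s < y) xs"
      using that less by (intro filter_cong) auto
    moreover have "no_drop x (filter (\<lambda>y. s < y) xs)"
      using that less by (intro no_drop_if_no_greater) force
    ultimately show ?thesis by (simp add: split_dec_def av123_dec_above_def)
  qed
  then have "count_perms (split_dec s x) S = count_perms (av123_dec_above s) S"
    by (intro count_perms_cong) auto
  moreover have "{y \<in> S. s < y \<and> y < x} = {y \<in> S. s < y}" using less by auto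
  ultimately show ?thesis using True count_av123_dec_above[OF assms(1), of s] by presburger
next
  case False
  have "real (count_perms (split_dec s x) S) =
    fps_nth (catalan_fps ^ Suc (card {y \<in> S. x < y})) (card {y \<in> S. y \<le> s})"
    using assms(1,3) False
  proof (induction "card S" arbitrary: S rule: less_induct)
    case less
    let ?M = "{y \<in> S. s < y \<and> y < x}" and ?H = "{y \<in> S. x < y}"
    show ?case
    proof (cases "?M = {}")
      case True
      have M: "y \<notin> ?M" for y using True by blast
      have "split_dec s x xs \<longleftrightarrow> av123_dec_above x xs" if "set xs = S" for xs
      proof -
        have "filter (\<lambda>y. s < y \<and> y < x) xs = []" using that M by (auto simp: filter_empty_conv)
        moreover have "no_drop x (filter (\<lambda>y. s < y) xs)"
          using that M by (intro no_drop_if_no_less) auto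
        ultimately show ?thesis by (simp add: split_dec_def av123_dec_above_def)
      qed
      then have "count_perms (split_dec s x) S = count_perms (av123_dec_above x) S"
        by (intro count_perms_cong) auto
      moreover have "y \<le> x \<longleftrightarrow> y \<le> s" if "y \<in> S" for y
        using M[of y] that assms(2) less.prems(2) by (cases "y = x") auto
      then have "{y \<in> S. y \<le> x} = {y \<in> S. y \<le> s}" by blast
      ultimately show ?thesis using count_av123_dec_above[OF less.prems(1), of x] by simp
    next
      case False
      define m where "m = Max ?M"
      have m: "m \<in> ?M" and max: "\<And>y. y \<in> ?M \<Longrightarrow> y \<le> m"
        using False less.prems Max_in[of ?M] unfolding m_def by auto
      obtain h where h: "h \<in> ?H" using less.prems(3) by blast
      have "count_perms (split_dec s x) S = count_perms (\<lambda>xs. split_dec s x (m # xs)) (S - {m})"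
      proof (rule count_perms_single_head[OF less.prems(1)])
        show "m \<in> S" using m by simp
        fix y xs assume y: "y \<in> S" "y \<noteq> m" and xs: "set xs = S - {y}"
        have "y \<noteq> x" using y less.prems(2) by auto
        then consider "y \<le> s" | "s < y" "y < x" | "x < y" by linarith
        then show "\<not> split_dec s x (y # xs)"
        proof cases
          case 1
          \<comment> \<open>A low first letter \<open>y\<close> is impossible: \<open>y\<close>,
            \<open>m\<close>, \<open>h\<close> is a 123 if \<open>m\<close> comes before
            \<open>h\<close>, and otherwise \<open>h\<close>, \<open>m\<close> drops across
            \<open>x\<close>.\<close>
          show ?thesis
          proof
            assume sd: "split_dec s x (y # xs)"
            then have *: "no_drop x (filter (\<lambda>y. s < y) xs)" "dec (filter (\<lambda>z. y < z) xs)"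
              using 1 by (auto simp: split_dec_def)
            have "m \<in> set xs" "h \<in> set xs" using m h 1 xs by auto
            then obtain p q where pq: "xs = p @ m # q" by (auto simp: in_set_conv_decomp)
            then have "h \<in> set p \<or> h \<in> set q" using \<open>h \<in> set xs\<close> m h by auto
            then show False
            proof
              assume "h \<in> set p"
              then have "subseq ([h] @ [m]) (p @ m # q)"
                by (intro list_emb_append_mono) (simp_all add: subseq_singleton_left)
              then have "subseq [h, m] (filter (\<lambda>y. s < y) xs)"
                unfolding subseq_filter_iff using m h pq by simp
              then show False using *(1) m h unfolding no_drop_iff_subseq by blast
            next
              assume "h \<in> set q"
              then have "subseq ([] @ [m, h]) (p @ m # q)"
                by (intro list_emb_append_mono) (simp_all add: subseq_singleton_left)
              then have "subseq [m, h] (filter (\<lambda>z. y < z) xs)"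
                unfolding subseq_filter_iff using m h pq 1 by simp
              moreover have "m < h" using m h by simp
              ultimately show False using *(2) unfolding dec_iff_subseq by blast
            qed
          qed
        next
          case 2
          then have "m \<in> set xs" "y < m" using max[of y] y m xs by simp_all
          then show ?thesis using 2 m by (auto simp: split_dec_def)
        next
          case 3
          then have "m \<in> set xs" using m xs by auto
          then show ?thesis using 3 m assms(2) by (auto simp: split_dec_def)
        qed
      qed
      also have "\<dots> = count_perms (split_dec s x) (S - {m})"
      proof (rule count_perms_cong)
        fix xs assume xs: "set xs = S - {m}"
        have "m < y \<longleftrightarrow> x < y" if "y \<in> set xs" for y
        proof -
          have "y \<in> S" "y \<noteq> m" "y \<noteq> x" using that xs less.prems(2) by auto
          then show ?thesis using max[of y] m by (cases "y < x"; cases "s < y") simp_all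
        qed
        then have "filter (\<lambda>y. m < y) xs = filter (\<lambda>y. x < y) xs" by (intro filter_cong) auto
        moreover have "\<forall>y\<in>set xs. s < y \<and> y < x \<longrightarrow> y \<le> m" using xs max by auto
        ultimately show "split_dec s x (m # xs) = split_dec s x xs"
          using m by (auto simp: split_dec_def)
      qed
      also have "real \<dots> = fps_nth (catalan_fps ^ Suc (card {y \<in> S - {m}. x < y})) (card {y \<in> S - {m}. y \<le> s})"
        using less m h card_Diff1_less[of S m] by (intro less.hyps) auto
      also have "{y \<in> S - {m}. x < y} = ?H" using m by auto
      also have "{y \<in> S - {m}. y \<le> s} = {y \<in> S. y \<le> s}" using m by auto
      finally show ?thesis .
    qed
  qed
  then show ?thesis using False by presburger
qed

subsection \<open>Counting what follows the maximum\<close>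

text \<open>
  With \<open>t\<close> the value just below the block \<open>B\<close> and \<open>s\<close> the last letter of \<open>D\<close> (or \<open>t\<close> if \<open>D\<close> is
  empty), these are the conditions that \<open>B\<close> and \<open>D\<close> impose on \<open>R\<close>.
\<close>

definition valid_tail :: "nat \<Rightarrow> nat \<Rightarrow> nat list \<Rightarrow> bool" where
  "valid_tail s t xs \<longleftrightarrow> av123 xs \<and> av231 (filter (\<lambda>y. s < y) xs) \<and>
     dec (filter (\<lambda>y. s < y \<and> y \<le> t) xs)"

text \<open>
  The generating function of words \<open>xs\<close> with \<open>valid_tail s t xs\<close> in which the variable marks the
  letters up to \<open>s\<close>, with \<open>m\<close> letters between \<open>s\<close> and \<open>t\<close> and \<open>u\<close> letters above \<open>t\<close>. The three
  summands of the second equation belong to a first letter of each of these three kinds.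
\<close>

primrec tail_fps :: "nat \<Rightarrow> nat \<Rightarrow> real fps" where
  "tail_fps m 0 = catalan_fps ^ Suc m"
| "tail_fps m (Suc u) = fps_X * catalan_fps ^ (m + Suc u + 2) +
     (if m = 0 then 0 else catalan_fps ^ Suc (Suc u)) +
     (tail_fps m u + (\<Sum>v<u. catalan_fps ^ (v + 2)))"

text \<open>Behind a low first letter all larger letters decrease, which already implies both
  conditions on the letters above \<open>s\<close>.\<close>

lemma valid_tail_Cons_low:
  assumes "x \<le> s" "s \<le> t"
  shows "valid_tail s t (x # xs) \<longleftrightarrow> av123_dec_above x xs"
proof
  assume "av123_dec_above x xs"
  moreover from this have "dec (filter (\<lambda>y. s < y) xs)" "dec (filter (\<lambda>y. s < y \<and> y \<le> t) xs)"
    using assms unfolding av123_dec_above_def by (auto elim!: dec_filter_mono)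
  ultimately show "valid_tail s t (x # xs)"
    using assms by (simp add: valid_tail_def av123_dec_above_def av231_if_dec)
qed (simp add: valid_tail_def av123_dec_above_def)

lemma valid_tail_if_split_dec:
  assumes "split_dec s x xs" "s < x" "x \<notin> set xs"
  shows "av123 (x # xs)" "av231 (filter (\<lambda>y. s < y) (x # xs))"
proof -
  show "av123 (x # xs)" using assms by (simp add: split_dec_def)
  have "filter (\<lambda>y. y < x) (filter (\<lambda>y. s < y) xs) = filter (\<lambda>y. s < y \<and> y < x) xs"
    by simp
  moreover have "filter (\<lambda>y. x < y) (filter (\<lambda>y. s < y) xs) = filter (\<lambda>y. x < y) xs"
    using assms(2) by (auto intro!: filter_cong)
  ultimately show "av231 (filter (\<lambda>y. s < y) (x # xs))"
    using assms av231_if_dec_parts[of x "filter (\<lambda>y. s < y) xs"] by (simp add: split_dec_def)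
qed

lemma valid_tail_Cons_mid:
  assumes "s < x" "x \<le> t" "x \<notin> set xs"
  shows "valid_tail s t (x # xs) \<longleftrightarrow>
    (\<forall>y\<in>set xs. s < y \<and> y \<le> t \<longrightarrow> y \<le> x) \<and> split_dec s x xs"
proof (cases "\<forall>y\<in>set xs. s < y \<and> y \<le> t \<longrightarrow> y \<le> x")
  case True
  then have "filter (\<lambda>y. s < y \<and> y \<le> t) xs = filter (\<lambda>y. s < y \<and> y < x) xs"
    using assms by (intro filter_cong) (auto simp: order.strict_iff_order)
  then show ?thesis
    using True assms valid_tail_if_split_dec[of s x xs]
    by (auto simp: valid_tail_def split_dec_def)
next
  case False
  then show ?thesis using assms by (auto simp: valid_tail_def)
qed

text \<open>The larger letter \<open>y\<close> still to come forces the letters between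
  \<open>s\<close> and \<open>x\<close> to decrease, and these include the ones up to
  \<open>t\<close>.\<close>

lemma valid_tail_Cons_high:
  assumes "s \<le> t" "t < x" "x \<notin> set xs" "y \<in> set xs" "x < y"
  shows "valid_tail s t (x # xs) \<longleftrightarrow> split_dec s x xs"
proof
  assume "valid_tail s t (x # xs)"
  moreover from this have "dec (filter (\<lambda>z. s < z \<and> z < x) xs)"
    using assms by (intro dec_between_if_no_drop[of xs x s y]) (auto simp: valid_tail_def)
  ultimately show "split_dec s x xs" using assms by (simp add: valid_tail_def split_dec_def)
next
  assume sd: "split_dec s x xs"
  then have "dec (filter (\<lambda>y. s < y \<and> y < x) xs)" by (simp add: split_dec_def)
  then have "dec (filter (\<lambda>y. s < y \<and> y \<le> t) xs)" by (rule dec_filter_mono) (use assms in auto)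
  then show "valid_tail s t (x # xs)"
    using valid_tail_if_split_dec[OF sd] assms by (simp add: valid_tail_def)
qed

lemma valid_tail_Cons_top:
  assumes "s \<le> t" "t < x" "\<And>y. y \<in> set xs \<Longrightarrow> y < x"
  shows "valid_tail s t (x # xs) \<longleftrightarrow> valid_tail s t xs"
proof -
  have "filter (\<lambda>y. x < y) xs = []" using assms(3) by (force simp: filter_empty_conv)
  moreover have "no_drop x (filter (\<lambda>y. s < y) xs)"
    using assms(3) by (intro no_drop_if_no_greater) force
  ultimately show ?thesis using assms(1,2) by (simp add: valid_tail_def)
qed

text \<open>The series in the shape that the sum over first letters produces. For
  \<open>u = 0\<close> it is C^(m+1) = C^m + z C^(m+2), and C^m is the share of the middle letters.
  If also \<open>m = 0\<close>, that term is the constant 1, which vanishes at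
  \<open>l \<noteq> 0\<close>.\<close>

lemma tail_fps_nth_split:
  assumes "l \<noteq> 0 \<or> m \<noteq> 0 \<or> u \<noteq> 0"
  shows "fps_nth (tail_fps m u) l =
    fps_nth (fps_X * catalan_fps ^ (m + u + 2)) l +
    ((if m = 0 then 0 else fps_nth (catalan_fps ^ (if u = 0 then m else Suc u)) l) +
     (\<Sum>i<u. case i of 0 \<Rightarrow> fps_nth (tail_fps m (u - 1)) l
        | Suc v \<Rightarrow> fps_nth (catalan_fps ^ (v + 2)) l))"
proof (cases u)
  case 0
  show ?thesis
    unfolding 0 tail_fps.simps catalan_fps_power_Suc using assms 0 by auto
next
  case (Suc u')
  show ?thesis unfolding Suc sum.lessThan_Suc_shift by (simp add: fps_sum_nth)
qed

lemma count_valid_tail: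
  assumes "finite S" "s \<le> t"
  shows "real (count_perms (valid_tail s t) S) =
    fps_nth (tail_fps (card {y \<in> S. s < y \<and> y \<le> t}) (card {y \<in> S. t < y})) (card {y \<in> S. y \<le> s})"
  using assms(1)
proof (induction "card S" arbitrary: S rule: less_induct)
  case less
  show ?case
  proof (cases "S = {}")
    case True
    then show ?thesis by (simp add: count_perms_empty valid_tail_def catalan_fps_nth_0)
  next
    case False
    let ?L = "{y \<in> S. y \<le> s}" and ?M = "{y \<in> S. s < y \<and> y \<le> t}" and ?H = "{y \<in> S. t < y}"
    let ?c = "\<lambda>x. real (count_perms (\<lambda>xs. valid_tail s t (x # xs)) (S - {x}))"
    have fin: "finite ?L" "finite ?M" "finite ?H" using less.prems by auto
    have "?c x = fps_nth (catalan_fps ^ Suc (card {y \<in> S. x < y})) (card {y \<in> S. y < x})"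
      if "x \<in> S" "x \<le> s" for x
      using that assms(2) less.prems count_av123_dec_above[of "S - {x}" x, unfolded filter_removed]
      by (simp add: valid_tail_Cons_low)
    then have L: "(\<Sum>x\<in>?L. ?c x) = fps_nth (fps_X * catalan_fps ^ (card {y \<in> S. s < y} + 2)) (card ?L)"
      using less.prems by (rule sum_low_heads[rotated])
    have "{y \<in> S. s < y} = ?M \<union> ?H" using assms(2) by auto
    then have "card {y \<in> S. s < y} = card ?M + card ?H"
      using fin card_Un_disjoint[of ?M ?H] by fastforce
    note L = L[unfolded this]
    have M: "(\<Sum>x\<in>?M. ?c x) = (if card ?M = 0 then 0
      else fps_nth (catalan_fps ^ (if card ?H = 0 then card ?M else Suc (card ?H))) (card ?L))"
    proof (cases "?M = {}")
      case True
      show ?thesis unfolding True by simp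
    next
      case nonempty: False
      define x where "x = Max ?M"
      have x: "x \<in> S" "s < x" "x \<le> t" and max: "\<And>y. y \<in> S \<Longrightarrow> s < y \<Longrightarrow> y \<le> t \<Longrightarrow> y \<le> x"
        using nonempty fin Max_in[of ?M] unfolding x_def by auto
      have "?c y = 0" if y: "y \<in> ?M - {x}" for y
      proof -
        have "\<not> valid_tail s t (y # xs)" if "set xs = S - {y}" for xs
          using x max[of y] y that by (auto simp: valid_tail_def)
        then show ?thesis by (simp add: count_perms_eq_0)
      qed
      then have "(\<Sum>y\<in>?M. ?c y) = ?c x"
        using fin(2) x by (subst sum.remove[of _ x]) auto
      also have "count_perms (\<lambda>xs. valid_tail s t (x # xs)) (S - {x}) =
                   count_perms (split_dec s x) (S - {x})"
      proof (rule count_perms_cong)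
        fix xs assume "set xs = S - {x}"
        then show "valid_tail s t (x # xs) = split_dec s x xs"
          using x max valid_tail_Cons_mid[of s x t xs] by auto
      qed
      also have "real \<dots> = fps_nth (catalan_fps ^ (if card ?H = 0 then card ?M else Suc (card ?H))) (card ?L)"
      proof -
        have 1: "{y \<in> S - {x}. x < y} = ?H" using x max by force
        have 2: "{y \<in> S - {x}. s < y \<and> y < x} = ?M - {x}" using x max by force
        have 3: "{y \<in> S - {x}. y \<le> s} = ?L" using x by auto
        have 4: "Suc (card (?M - {x})) = card ?M"
          using x fin by (intro card.remove[symmetric]) auto
        have 5: "card ?H = 0 \<longleftrightarrow> ?H = {}" using fin by simp
        have "real (count_perms (split_dec s x) (S - {x})) =
          (if ?H = {} then fps_nth (catalan_fps ^ card ?M) (card ?L)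
           else fps_nth (catalan_fps ^ Suc (card ?H)) (card ?L))"
          using count_split_dec[of "S - {x}" s x, unfolded 1 2 3 4] less.prems x(2) by blast
        then show ?thesis unfolding 5 by presburger
      qed
      finally have "(\<Sum>x\<in>?M. ?c x) = \<dots>" .
      moreover have "card ?M \<noteq> 0" using fin nonempty by (metis card_0_eq)
      ultimately show ?thesis by presburger
    qed
    \<comment> \<open>The argument is the number of letters above the first letter \<open>x\<close>.
      At 0, \<open>x\<close> is the maximum and imposes nothing on the rest; otherwise
      \<open>split_dec\<close> applies, with a count depending only on that number and on
      \<open>card ?L\<close>.\<close>
    define g where "g = (\<lambda>i. case i of 0 \<Rightarrow> fps_nth (tail_fps (card ?M) (card ?H - 1)) (card ?L)
      | Suc v \<Rightarrow> fps_nth (catalan_fps ^ (v + 2)) (card ?L))"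
    have "?c x = g (card {y \<in> ?H. x < y})" if x: "x \<in> ?H" for x
    proof (cases "{y \<in> ?H. x < y} = {}")
      case True
      then have max: "y < x" if "y \<in> S - {x}" for y
        using x that by (metis (mono_tags, lifting) Diff_iff empty_Collect_eq insertI1 less_trans mem_Collect_eq nat_neq_iff)
      have "count_perms (\<lambda>xs. valid_tail s t (x # xs)) (S - {x}) = count_perms (valid_tail s t) (S - {x})"
        using x assms(2) max by (intro count_perms_cong valid_tail_Cons_top) auto
      also have "real \<dots> = fps_nth (tail_fps (card {y \<in> S - {x}. s < y \<and> y \<le> t})
          (card {y \<in> S - {x}. t < y})) (card {y \<in> S - {x}. y \<le> s})"
        using x less.prems card_Diff1_less[of S x] by (intro less.hyps) auto
      also have "{y \<in> S - {x}. s < y \<and> y \<le> t} = ?M" using x by auto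
      also have "{y \<in> S - {x}. y \<le> s} = ?L" using x assms(2) by auto
      also have "{y \<in> S - {x}. t < y} = ?H - {x}" by auto
      also have "card \<dots> = card ?H - 1" using x by (rule card_Diff_singleton)
      finally show ?thesis unfolding True g_def by simp
    next
      case False
      then obtain y where y: "y \<in> S" "x < y" by blast
      have "count_perms (\<lambda>xs. valid_tail s t (x # xs)) (S - {x}) = count_perms (split_dec s x) (S - {x})"
        using x assms(2) y by (intro count_perms_cong valid_tail_Cons_high[of s t x _ y]) auto
      moreover have "{y \<in> S - {x}. x < y} = {y \<in> ?H. x < y}" using x by auto
      moreover have "{y \<in> S - {x}. y \<le> s} = ?L" using x assms(2) by auto
      ultimately have "?c x = fps_nth (catalan_fps ^ Suc (card {y \<in> ?H. x < y})) (card ?L)"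
        using count_split_dec[of "S - {x}" s x] less.prems x assms(2) False by auto
      moreover obtain v where "card {y \<in> ?H. x < y} = Suc v"
        using False fin(3) by (metis (no_types, lifting) card_0_eq finite_subset mem_Collect_eq not0_implies_Suc subsetI)
      ultimately show ?thesis unfolding g_def by simp
    qed
    then have "(\<Sum>x\<in>?H. ?c x) = (\<Sum>i<card ?H. g i)"
      using sum_rank_above[OF fin(3), of g] by simp
    moreover have "real (count_perms (valid_tail s t) S) = (\<Sum>x\<in>S. ?c x)"
      using less.prems False by (simp add: count_perms_rec)
    moreover have "(\<Sum>x\<in>S. ?c x) = (\<Sum>x\<in>?L. ?c x) + ((\<Sum>x\<in>?M. ?c x) + (\<Sum>x\<in>?H. ?c x))"
    proof -
      have "S = ?L \<union> (?M \<union> ?H)" using assms(2) by auto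
      then have "(\<Sum>x\<in>S. ?c x) = sum ?c (?L \<union> (?M \<union> ?H))" by presburger
      also have "\<dots> = (\<Sum>x\<in>?L. ?c x) + (\<Sum>x\<in>?M \<union> ?H. ?c x)"
        using fin assms(2) by (intro sum.union_disjoint) auto
      also have "(\<Sum>x\<in>?M \<union> ?H. ?c x) = (\<Sum>x\<in>?M. ?c x) + (\<Sum>x\<in>?H. ?c x)"
        using fin by (intro sum.union_disjoint) auto
      finally show ?thesis .
    qed
    moreover have "S = ?L \<union> (?M \<union> ?H)" using assms(2) by auto
    then have "card ?L \<noteq> 0 \<or> card ?M \<noteq> 0 \<or> card ?H \<noteq> 0"
      using False fin by (metis (no_types, lifting) card_0_eq sup_bot.right_neutral)
    then have "fps_nth (tail_fps (card ?M) (card ?H)) (card ?L) =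
      fps_nth (fps_X * catalan_fps ^ (card ?M + card ?H + 2)) (card ?L) +
      ((if card ?M = 0 then 0
        else fps_nth (catalan_fps ^ (if card ?H = 0 then card ?M else Suc (card ?H))) (card ?L)) +
       (\<Sum>i<card ?H. g i))"
      unfolding g_def by (rule tail_fps_nth_split)
    ultimately show ?thesis using L M by presburger
  qed
qed

section \<open>Closed forms of the tail series\<close>

definition catalan_tri :: "nat \<Rightarrow> real fps" where
  "catalan_tri u = (\<Sum>v<u. \<Sum>w<v. catalan_fps ^ (w + 2))"

lemma catalan_tri_Suc: "catalan_tri (Suc u) = catalan_tri u + (\<Sum>w<u. catalan_fps ^ (w + 2))"
  by (simp add: catalan_tri_def)

lemma tail_fps_0: "tail_fps 0 u = catalan_fps ^ Suc u + catalan_tri u"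
proof (induction u)
  case (Suc u)
  have "catalan_fps ^ Suc (Suc u) = catalan_fps ^ Suc u + fps_X * catalan_fps ^ (Suc u + 2)"
    by (rule catalan_fps_power_Suc)
  then show ?case unfolding tail_fps.simps Suc.IH catalan_tri_Suc by (simp add: add_ac)
qed (simp add: catalan_tri_def)

text \<open>The middle first letter contributes C^(u+2), which is the next term of the sum over the
  high first letters below the maximum. This is why the argument of \<open>catalan_tri\<close> is
  one larger than for \<open>m = 0\<close>.\<close>

lemma tail_fps_pos: "m > 0 \<Longrightarrow> tail_fps m u = catalan_fps ^ Suc (m + u) + catalan_tri (Suc u)"
proof (induction u)
  case (Suc u)
  have "catalan_fps ^ Suc (m + Suc u) = catalan_fps ^ (m + Suc u) + fps_X * catalan_fps ^ (m + Suc u + 2)"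
    by (rule catalan_fps_power_Suc)
  then show ?case
    unfolding tail_fps.simps Suc.IH[OF Suc.prems] catalan_tri_Suc[of "Suc u"]
    using Suc.prems by (simp add: catalan_tri_Suc add_ac)
qed (simp add: catalan_tri_def)

lemma sum_fps_nth_telescope:
  "(\<Sum>i<n. fps_nth ((1 - fps_X) * g) i) = fps_nth (fps_X * g) n" for g :: "'a :: comm_ring_1 fps"
proof (induction n)
  case (Suc n)
  then show ?case by (cases n) (simp_all add: algebra_simps)
qed simp

text \<open>Choosing the next letter of D restarts the count with fewer low letters. With t_l the
  coefficients of \<open>catalan_tri (Suc u)\<close>, the share a_l of these terms satisfies a_l =
  t_l + (sum of a_i over i < l). The solution has the extra factor (1 - z) / (1 - 2z), of which 1 -
  z is left out here so that it can telescope the sum.\<close>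

definition pair_corr :: "nat \<Rightarrow> real fps" where
  "pair_corr u = catalan_tri (Suc u) * inverse (1 - 2 * fps_X)"

lemma pair_corr_eq: "(1 - fps_X) * pair_corr u = catalan_tri (Suc u) + fps_X * pair_corr u"
proof -
  have "(1 - 2 * fps_X) * inverse (1 - 2 * fps_X) = (1 :: real fps)"
    by (subst mult.commute, rule inverse_mult_eq_1) simp
  then have "(1 - 2 * fps_X) * pair_corr u = catalan_tri (Suc u)"
    unfolding pair_corr_def by (metis mult.left_commute mult_1_right)
  then show ?thesis by (simp add: algebra_simps)
qed

section \<open>Counting the pairs (D, R)\<close>

definition dec_pairs :: "nat \<Rightarrow> nat \<Rightarrow> nat set \<Rightarrow> (nat list \<times> nat list) set" where
  "dec_pairs s t S = {(D, R). distinct (D @ R) \<and> set (D @ R) = S \<and> dec D \<and> (\<forall>d\<in>set D. d \<le> s) \<and>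
     valid_tail (last (s # D)) t R}"

lemma dec_pairs_rec:
  "dec_pairs s t S = Pair [] ` {R \<in> permutations_of_set S. valid_tail s t R} \<union>
     (\<Union>d\<in>{y \<in> S. y \<le> s}. (\<lambda>(D, R). (d # D, R)) ` dec_pairs d t (S - {d}))"
proof (intro equalityI subsetI)
  fix z assume z: "z \<in> dec_pairs s t S"
  obtain D R where DR: "z = (D, R)" by fastforce
  show "z \<in> Pair [] ` {R \<in> permutations_of_set S. valid_tail s t R} \<union>
     (\<Union>d\<in>{y \<in> S. y \<le> s}. (\<lambda>(D, R). (d # D, R)) ` dec_pairs d t (S - {d}))"
  proof (cases D)
    case Nil
    then show ?thesis using z DR by (auto simp: dec_pairs_def permutations_of_set_def)
  next
    case (Cons d D')
    then have "(D', R) \<in> dec_pairs d t (S - {d})" "d \<in> S" "d \<le> s"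
      using z DR by (auto simp: dec_pairs_def)
    then show ?thesis unfolding DR Cons by force
  qed
next
  fix z assume "z \<in> Pair [] ` {R \<in> permutations_of_set S. valid_tail s t R} \<union>
     (\<Union>d\<in>{y \<in> S. y \<le> s}. (\<lambda>(D, R). (d # D, R)) ` dec_pairs d t (S - {d}))"
  then show "z \<in> dec_pairs s t S"
    by (auto simp: dec_pairs_def permutations_of_set_def intro: le_trans)
qed

lemma finite_dec_pairs: "finite S \<Longrightarrow> finite (dec_pairs s t S)"
  by (rule finite_subset[of _ "{xs. set xs \<subseteq> S \<and> distinct xs} \<times> {xs. set xs \<subseteq> S \<and> distinct xs}"])
     (auto simp: dec_pairs_def finite_subset_distinct)

lemma card_pairs_by_head:
  assumes "finite S" "T \<subseteq> S"
  shows "card (Pair [] ` {R \<in> permutations_of_set S. valid_tail s t R} \<union>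
     (\<Union>d\<in>T. (\<lambda>(D, R). (d # D, R)) ` dec_pairs d t (S - {d}))) =
     count_perms (valid_tail s t) S + (\<Sum>d\<in>T. card (dec_pairs d t (S - {d})))"
proof -
  have "finite T" using assms finite_subset by blast
  have "card (\<Union>d\<in>T. (\<lambda>(D, R). (d # D, R)) ` dec_pairs d t (S - {d})) =
    (\<Sum>d\<in>T. card ((\<lambda>(D, R). (d # D, R)) ` dec_pairs d t (S - {d})))"
    using assms(1) \<open>finite T\<close> by (intro card_UN_disjoint) (auto simp: finite_dec_pairs)
  also have "\<dots> = (\<Sum>d\<in>T. card (dec_pairs d t (S - {d})))"
    by (intro sum.cong card_image) (auto simp: inj_on_def)
  finally show ?thesis
    using assms(1) \<open>finite T\<close>
    by (subst card_Un_disjoint) (auto simp: finite_dec_pairs count_perms_def card_image inj_on_def)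
qed

text \<open>If D starts with \<open>d\<close>, the low letters above \<open>d\<close> become middle
  letters and \<open>s\<close> becomes \<open>d\<close>. The middle set only grows, so it stays
  nonempty and one formula covers all \<open>d\<close>. The Catalan powers then sum along a
  diagonal, and the \<open>pair_corr\<close> terms telescope.\<close>

lemma card_dec_pairs:
  assumes "finite S" "s \<le> t" "{y \<in> S. s < y \<and> y \<le> t} \<noteq> {}"
  shows "real (card (dec_pairs s t S)) =
    fps_nth (catalan_fps ^ (card {y \<in> S. s < y \<and> y \<le> t} + card {y \<in> S. t < y} + 2) +
      (1 - fps_X) * pair_corr (card {y \<in> S. t < y})) (card {y \<in> S. y \<le> s})"
  using assms
proof (induction "card S" arbitrary: S s rule: less_induct)
  case less
  let ?L = "{y \<in> S. y \<le> s}" and ?M = "{y \<in> S. s < y \<and> y \<le> t}" and ?H = "{y \<in> S. t < y}"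
  define l m u where "l = card ?L" and "m = card ?M" and "u = card ?H"
  have "m > 0" using less.prems by (simp add: m_def card_gt_0_iff)
  define f where "f i = fps_nth (catalan_fps ^ (l + (m + u + 1) - i) + (1 - fps_X) * pair_corr u) i" for i
  have "real (card (dec_pairs d t (S - {d}))) = f (card {y \<in> ?L. y < d})" if d: "d \<in> ?L" for d
  proof -
    have "?L = {y \<in> ?L. y < d} \<union> insert d {y \<in> S. d < y \<and> y \<le> s}" using d by auto
    then have "l = card ({y \<in> ?L. y < d} \<union> insert d {y \<in> S. d < y \<and> y \<le> s})"
      unfolding l_def by (rule arg_cong)
    also have "\<dots> = card {y \<in> ?L. y < d} + Suc (card {y \<in> S. d < y \<and> y \<le> s})"
      using less.prems by (subst card_Un_disjoint) auto
    finally have l: "l = \<dots>" .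
    have "{y \<in> S - {d}. d < y \<and> y \<le> t} = {y \<in> S. d < y \<and> y \<le> s} \<union> ?M" using d less.prems by auto
    then have M: "card {y \<in> S - {d}. d < y \<and> y \<le> t} = card {y \<in> S. d < y \<and> y \<le> s} + m"
      unfolding m_def using less.prems card_Un_disjoint[of "{y \<in> S. d < y \<and> y \<le> s}" ?M] by fastforce
    have H: "{y \<in> S - {d}. t < y} = ?H" using d less.prems by auto
    have L: "{y \<in> S - {d}. y \<le> d} = {y \<in> ?L. y < d}" using d by auto
    obtain z where "z \<in> ?M" using less.prems(3) by blast
    then have "z \<in> {y \<in> S - {d}. d < y \<and> y \<le> t}" using d by auto
    then have ne: "{y \<in> S - {d}. d < y \<and> y \<le> t} \<noteq> {}" by blast
    have "real (card (dec_pairs d t (S - {d}))) = fps_nth (catalan_fps ^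
        (card {y \<in> S - {d}. d < y \<and> y \<le> t} + card {y \<in> S - {d}. t < y} + 2) +
        (1 - fps_X) * pair_corr (card {y \<in> S - {d}. t < y})) (card {y \<in> S - {d}. y \<le> d})"
      using less.prems d ne card_Diff1_less[of S d] by (intro less.hyps) auto
    moreover have "card {y \<in> S. d < y \<and> y \<le> s} + m + u + 2 = l + (m + u + 1) - card {y \<in> ?L. y < d}"
      using l by simp
    ultimately show ?thesis unfolding f_def M H L u_def by presburger
  qed
  then have "(\<Sum>d\<in>?L. real (card (dec_pairs d t (S - {d})))) = (\<Sum>i<l. f i)"
    using sum_rank_below[of ?L f] less.prems(1) by (simp add: l_def)
  also have "\<dots> = fps_nth (fps_X * catalan_fps ^ (m + u + 1 + 2)) l + fps_nth (fps_X * pair_corr u) l"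
    unfolding f_def fps_add_nth sum.distrib sum_catalan_fps_powers sum_fps_nth_telescope ..
  finally have "(\<Sum>d\<in>?L. real (card (dec_pairs d t (S - {d})))) = \<dots>" .
  moreover have "real (count_perms (valid_tail s t) S) = fps_nth (tail_fps m u) l"
    unfolding m_def u_def l_def using less.prems by (intro count_valid_tail)
  moreover have "card (dec_pairs s t S) =
    count_perms (valid_tail s t) S + (\<Sum>d\<in>?L. card (dec_pairs d t (S - {d})))"
    by (subst dec_pairs_rec, rule card_pairs_by_head) (use less.prems in auto)
  moreover have "catalan_fps ^ (m + u + 2) = catalan_fps ^ Suc (m + u) + fps_X * catalan_fps ^ (m + u + 1 + 2)"
    using catalan_fps_power_Suc[of "m + u + 1"] by simp
  ultimately show ?case
    unfolding m_def[symmetric] u_def[symmetric] l_def[symmetric]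
    by (simp only: tail_fps_pos[OF \<open>m > 0\<close>] pair_corr_eq fps_add_nth of_nat_add of_nat_sum add_ac)
qed

text \<open>
  Here \<open>D\<close> must not contain \<open>t\<close>, since otherwise \<open>B\<close> would not be separated from \<open>D\<close> by a value
  of \<open>R\<close>.
\<close>

definition frame_fps :: "nat \<Rightarrow> real fps" where
  "frame_fps u = catalan_fps ^ Suc u + catalan_tri u +
     fps_X ^ 2 * (catalan_fps ^ (u + 4) + pair_corr u)"

text \<open>For empty D there are no middle letters. Otherwise the first letter of D lies below
  \<open>t\<close>, so \<open>t\<close> is a middle letter and the previous count applies. One
  factor of \<open>fps_X ^ 2\<close> comes from the sum over that first letter, the other marks
  \<open>t\<close>. The second alternative of the hypothesis serves \<open>t = 0\<close>.\<close>

lemma card_dec_pairs_avoiding: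
  assumes "finite S" "t \<in> S \<or> {y \<in> S. y \<le> t} = {}"
  shows "real (card {(D, R) \<in> dec_pairs t t S. t \<notin> set D}) =
    fps_nth (frame_fps (card {y \<in> S. t < y})) (card {y \<in> S. y \<le> t})"
proof -
  let ?L = "{y \<in> S. y < t}" and ?H = "{y \<in> S. t < y}"
  define l u where "l = card ?L" and "u = card ?H"
  define f where "f i = fps_nth (catalan_fps ^ (l + (u + 2) - i) + (1 - fps_X) * pair_corr u) i" for i
  have "{(D, R) \<in> dec_pairs t t S. t \<notin> set D} =
    Pair [] ` {R \<in> permutations_of_set S. valid_tail t t R} \<union>
     (\<Union>d\<in>?L. (\<lambda>(D, R). (d # D, R)) ` dec_pairs d t (S - {d}))" (is "?A = ?B")
  proof (rule set_eqI)
    fix z :: "nat list \<times> nat list"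
    have "t \<notin> set D" if "(D, R) \<in> dec_pairs d t (S - {d})" "d < t" for d D R
      using that by (auto simp: dec_pairs_def)
    then show "z \<in> ?A \<longleftrightarrow> z \<in> ?B"
      by (subst dec_pairs_rec) (cases z; auto; force)
  qed
  then have "card ?A = count_perms (valid_tail t t) S + (\<Sum>d\<in>?L. card (dec_pairs d t (S - {d})))"
    using assms(1) by (simp add: card_pairs_by_head)
  moreover have "real (card (dec_pairs d t (S - {d}))) = f (card {y \<in> ?L. y < d})" if d: "d \<in> ?L" for d
  proof -
    have "t \<in> S" using assms(2) d by auto
    have "?L = {y \<in> ?L. y < d} \<union> insert d {y \<in> S. d < y \<and> y < t}" using d by auto
    then have "l = card ({y \<in> ?L. y < d} \<union> insert d {y \<in> S. d < y \<and> y < t})"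
      unfolding l_def by (rule arg_cong)
    also have "\<dots> = card {y \<in> ?L. y < d} + Suc (card {y \<in> S. d < y \<and> y < t})"
      using assms(1) by (subst card_Un_disjoint) auto
    finally have l: "l = \<dots>" .
    have "{y \<in> S - {d}. d < y \<and> y \<le> t} = insert t {y \<in> S. d < y \<and> y < t}" using d \<open>t \<in> S\<close> by auto
    then have M: "card {y \<in> S - {d}. d < y \<and> y \<le> t} = Suc (card {y \<in> S. d < y \<and> y < t})"
      using assms(1) by simp
    have H: "{y \<in> S - {d}. t < y} = ?H" using d by auto
    have L: "{y \<in> S - {d}. y \<le> d} = {y \<in> ?L. y < d}" using d by auto
    have "real (card (dec_pairs d t (S - {d}))) = fps_nth (catalan_fps ^
        (card {y \<in> S - {d}. d < y \<and> y \<le> t} + card {y \<in> S - {d}. t < y} + 2) +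
        (1 - fps_X) * pair_corr (card {y \<in> S - {d}. t < y})) (card {y \<in> S - {d}. y \<le> d})"
      using assms(1) d \<open>t \<in> S\<close> by (intro card_dec_pairs) auto
    moreover have "Suc (card {y \<in> S. d < y \<and> y < t}) + u + 2 = l + (u + 2) - card {y \<in> ?L. y < d}"
      using l by simp
    ultimately show ?thesis unfolding f_def M H L u_def by presburger
  qed
  then have "(\<Sum>d\<in>?L. real (card (dec_pairs d t (S - {d})))) = (\<Sum>i<l. f i)"
    using sum_rank_below[of ?L f] assms(1) by (simp add: l_def)
  moreover have "(\<Sum>i<l. f i) = fps_nth (fps_X * (catalan_fps ^ (u + 4) + pair_corr u)) l"
    unfolding f_def fps_add_nth sum.distrib sum_catalan_fps_powers sum_fps_nth_telescope
    by (simp add: distrib_left eval_nat_numeral)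
  moreover have "\<dots> = fps_nth (fps_X ^ 2 * (catalan_fps ^ (u + 4) + pair_corr u)) (card {y \<in> S. y \<le> t})"
  proof (cases "t \<in> S")
    case True
    then have "{y \<in> S. y \<le> t} = insert t ?L" by auto
    then have "card {y \<in> S. y \<le> t} = Suc l" using assms(1) by (simp add: l_def)
    then show ?thesis by (simp add: power2_eq_square mult.assoc)
  next
    case False
    then have "{y \<in> S. y \<le> t} = {}" using assms(2) by blast
    moreover from this have "?L = {}" by (auto dest: less_imp_le)
    ultimately show ?thesis by (simp add: l_def power2_eq_square mult.assoc)
  qed
  moreover have "real (count_perms (valid_tail t t) S) =
    fps_nth (catalan_fps ^ Suc u + catalan_tri u) (card {y \<in> S. y \<le> t})"
  proof -
    have "{y \<in> S. t < y \<and> y \<le> t} = {}" by auto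
    from count_valid_tail[OF assms(1), of t t, unfolded this card.empty tail_fps_0]
    show ?thesis by (simp add: u_def)
  qed
  ultimately show ?thesis by (simp add: frame_fps_def u_def)
qed

subsection \<open>Decomposition at the maximum\<close>

lemma av_both_subseq: "subseq ys xs \<Longrightarrow> av_both xs \<Longrightarrow> av_both ys"
  unfolding av_both_iff_subseq by (meson subseq_order.order_trans)

lemma av_both_if_av123:
  assumes "av123 xs"
  shows "av_both xs"
  unfolding av_both_iff_subseq
proof (intro allI impI)
  fix a b c d assume abcd: "subseq [a, b, c, d] xs"
  have "subseq [b, c, d] [a, b, c, d]" "subseq [a, b, c] [a, b, c, d]" by simp_all
  then have "subseq [b, c, d] xs" "subseq [a, b, c] xs"
    using abcd subseq_order.order_trans by blast+
  then have 1: "\<not> (b < c \<and> c < d)" and 2: "\<not> (a < b \<and> b < c)"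
    using assms unfolding av123_iff_subseq by blast+
  show "\<not> (b < c \<and> c < d \<and> d < a) \<and> \<not> (a < d \<and> d < b \<and> b < c)"
    using 1 2 by linarith
qed

lemma av123_dec_append:
  assumes "dec xs" "av123 ys" "\<And>x. x \<in> set xs \<Longrightarrow> k \<le> x" "dec (filter (\<lambda>y. k < y) ys)"
  shows "av123 (xs @ ys)"
  using assms
proof (induction xs)
  case (Cons x xs)
  have "filter (\<lambda>y. x < y) xs = []" using Cons.prems(1) by (auto simp: filter_empty_conv)
  moreover have "dec (filter (\<lambda>y. x < y) ys)"
    using Cons.prems(3,4) by (intro dec_above_antimono[of k ys x]) auto
  ultimately show ?case using Cons by simp
qed simp

lemma av123_append_below:
  assumes "\<And>x y. x \<in> set xs \<Longrightarrow> y \<in> set ys \<Longrightarrow> y < x"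
  shows "av123 (xs @ ys) \<longleftrightarrow> av123 xs \<and> av123 ys"
  using assms
proof (induction xs)
  case (Cons x xs)
  have "filter (\<lambda>y. x < y) ys = []" using Cons.prems[of x] by (force simp: filter_empty_conv)
  then show ?case using Cons by auto
qed simp

lemma no_drop_append_above:
  assumes "\<And>y. y \<in> set ys \<Longrightarrow> x < y"
  shows "no_drop x (xs @ ys) \<longleftrightarrow> no_drop x xs"
proof (induction xs)
  case Nil
  then show ?case using assms by (simp add: no_drop_if_no_less less_imp_not_less)
next
  case (Cons y xs)
  then show ?case using assms by (auto dest: less_not_sym)
qed

lemma av231_append_above:
  assumes "\<And>x y. x \<in> set xs \<Longrightarrow> y \<in> set ys \<Longrightarrow> x < y"
  shows "av231 (xs @ ys) \<longleftrightarrow> av231 xs \<and> av231 ys"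
  using assms by (induction xs) (auto simp: no_drop_append_above)

lemma av231_filter: "av231 xs \<Longrightarrow> av231 (filter P xs)"
  unfolding av231_iff_subseq subseq_filter_iff by blast

lemma av231_Cons_top:
  assumes "\<And>y. y \<in> set xs \<Longrightarrow> y < M"
  shows "av231 (M # xs) \<longleftrightarrow> av231 xs"
  using assms by (auto simp: no_drop_if_no_greater less_not_sym)

lemma filter_above_mono:
  fixes a b :: nat
  shows "a \<le> b \<Longrightarrow> filter (\<lambda>y. b < y) (filter (\<lambda>y. a < y) xs) = filter (\<lambda>y. b < y) xs"
  by (auto intro!: filter_cong)

lemma av_both_max_Cons:
  assumes "\<And>r. r \<in> set R \<Longrightarrow> r < M"
  shows "av_both (M # R) \<longleftrightarrow> av123 R"
proof -
  have 1: "filter (\<lambda>y. y < M) R = R" and 2: "filter (\<lambda>y. M < y) R = []"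
    using assms by (auto simp: filter_id_conv filter_empty_conv dest: less_not_sym)
  show ?thesis unfolding av_both.simps 1 2 by (auto simp: av_both_if_av123)
qed

text \<open>Each \<open>d\<close> is at least \<open>s\<close>. Below \<open>d\<close>, the
  decreasing rest of D meets only letters of R whose part above \<open>s\<close> decreases, so no
  123 arises; above \<open>d\<close>, only \<open>M\<close> and part of a 231-avoiding word
  remain.\<close>

lemma av_both_dec_append:
  assumes "dec D" "\<And>d. d \<in> set D \<Longrightarrow> s \<le> d \<and> d < p" "p < M" "\<And>r. r \<in> set R \<Longrightarrow> r < M" "valid_tail s p R"
  shows "av_both (D @ M # R)"
  using assms(1,2)
proof (induction D)
  case Nil
  have "av123 R" using assms(5) by (simp add: valid_tail_def)
  then show ?case using assms(4) by (simp add: av_both_max_Cons del: av_both.simps)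
next
  case (Cons d D)
  have d: "s \<le> d" "d < p" using Cons.prems(2) by auto
  have "av123 (filter (\<lambda>y. y < d) D @ filter (\<lambda>y. y < d) R)"
  proof (rule av123_dec_append[where k = s])
    show "dec (filter (\<lambda>y. y < d) D)" using Cons.prems(1) by (simp add: dec_filter)
    have "dec (filter (\<lambda>y. s < y \<and> y \<le> p) R)" using assms(5) by (simp add: valid_tail_def)
    then have "dec (filter (\<lambda>y. y < d \<and> s < y) R)" by (rule dec_filter_mono) (use d in auto)
    then show "dec (filter (\<lambda>y. s < y) (filter (\<lambda>y. y < d) R))" by simp
    show "av123 (filter (\<lambda>y. y < d) R)"
      using assms(5) unfolding valid_tail_def av123_iff_subseq subseq_filter_iff by blast
  qed (use Cons.prems(2) in auto)
  moreover have "filter (\<lambda>y. d < y) D = []" using Cons.prems(1) by (auto simp: filter_empty_conv)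
  moreover have "av231 (M # filter (\<lambda>y. d < y) R)"
  proof -
    have "av231 (filter (\<lambda>y. d < y) (filter (\<lambda>y. s < y) R))"
      using assms(5) unfolding valid_tail_def by (blast intro: av231_filter)
    then have "av231 (filter (\<lambda>y. d < y) R)" unfolding filter_above_mono[OF d(1)] .
    then show ?thesis using assms(4) by (subst av231_Cons_top) auto
  qed
  moreover have "d < M" using d assms(3) by simp
  ultimately show ?case using Cons by (simp add: less_not_sym)
qed

text \<open>Below a letter of \<open>B\<close> stand first letters of \<open>B\<close> and then
  smaller letters of \<open>D\<close> and \<open>R\<close>; no 123 crosses such a descent. Above it
  stand first letters of \<open>B\<close> and then the larger \<open>M\<close> and letters of
  \<open>R\<close>; no 231 crosses such an ascent. So \<open>B\<close> need only avoid the patterns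
  by itself.\<close>

lemma av_both_construct:
  assumes "av_both B" "dec D" "valid_tail (last (p # D)) p R" "p < M"
    and "\<And>b. b \<in> set B \<Longrightarrow> p < b \<and> b < M" "\<And>d. d \<in> set D \<Longrightarrow> d < p"
    and "\<And>r. r \<in> set R \<Longrightarrow> r < M \<and> (r \<le> p \<or> (\<forall>b\<in>set B. b < r))"
  shows "av_both (B @ D @ M # R)"
  using assms(1,5,7)
proof (induction B)
  define s where "s = last (p # D)"
  have valid: "valid_tail s p R" using assms(3) by (simp add: s_def)
  have s: "s \<le> p" "s \<le> d" if "d \<in> set D" for d
  proof -
    have "s \<in> set D" using that by (auto simp: s_def)
    then show "s \<le> p" using assms(6) by (simp add: less_imp_le)
    have "D \<noteq> []" using that by auto
    then have D: "butlast D @ [s] = D" by (simp add: s_def)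
    have "dec (butlast D @ [s])" "d \<in> set (butlast D @ [s])" unfolding D using assms(2) that .
    then show "s \<le> d" by (auto simp: sorted_wrt_append)
  qed
  have "s \<le> p" using s(1)[of "hd D"] by (cases "D = []") (simp_all add: s_def)
  {
    case Nil
    then show ?case
      using assms(2,4,6) valid s by (auto intro!: av_both_dec_append[where s = s and p = p])
  next
    case (Cons b B)
    have b: "p < b" "b < M" using Cons.prems by auto
    have BR: "b' < r" if "b' \<in> set B" "r \<in> set R" "b < r" for b' r
      using that Cons.prems(3)[of r] b by auto
    have "filter (\<lambda>y. y < b) R = filter (\<lambda>y. y \<le> p) R"
      using Cons.prems(3) b by (intro filter_cong) (auto dest: less_not_sym)
    moreover have "filter (\<lambda>y. y < b) D = D" using assms(6) b by (force simp: filter_id_conv)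
    moreover have "av123 (filter (\<lambda>y. y < b) B @ D @ filter (\<lambda>y. y \<le> p) R)"
    proof (subst av123_append_below)
      have "av123 (D @ filter (\<lambda>y. y \<le> p) R)"
      proof (rule av123_dec_append[OF assms(2), where k = s])
        show "av123 (filter (\<lambda>y. y \<le> p) R)"
          using valid unfolding valid_tail_def av123_iff_subseq subseq_filter_iff by blast
        have "filter (\<lambda>y. s < y) (filter (\<lambda>y. y \<le> p) R) = filter (\<lambda>y. s < y \<and> y \<le> p) R"
          by (simp add: conj_commute)
        then show "dec (filter (\<lambda>y. s < y) (filter (\<lambda>y. y \<le> p) R))"
          using valid by (simp add: valid_tail_def)
      qed (use s in auto)
      moreover have "av123 (filter (\<lambda>y. y < b) B)" using Cons.prems(1) by simp
      ultimately show "av123 (filter (\<lambda>y. y < b) B) \<and> av123 (D @ filter (\<lambda>y. y \<le> p) R)" by blast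
    qed (use Cons.prems(2) assms(6) in \<open>force\<close>)
    moreover have "filter (\<lambda>y. b < y) D = []" using assms(6) b by (force simp: filter_empty_conv)
    moreover have "av231 (filter (\<lambda>y. b < y) B @ M # filter (\<lambda>y. b < y) R)"
    proof (subst av231_append_above)
      have "av231 (filter (\<lambda>y. b < y) (filter (\<lambda>y. s < y) R))"
        using valid unfolding valid_tail_def by (blast intro: av231_filter)
      moreover have "s \<le> b" using \<open>s \<le> p\<close> b by simp
      ultimately have "av231 (filter (\<lambda>y. b < y) R)" by (simp only: filter_above_mono)
      then have "av231 (M # filter (\<lambda>y. b < y) R)"
        using Cons.prems(3) by (subst av231_Cons_top) auto
      then show "av231 (filter (\<lambda>y. b < y) B) \<and> av231 (M # filter (\<lambda>y. b < y) R)"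
        using Cons.prems(1) by simp
    qed (use Cons.prems(2) BR in auto)
    moreover have "av_both (B @ D @ M # R)" using Cons by auto
    ultimately show ?case using b by (simp add: less_not_sym)
  }
qed

lemma filter_append_if_no_inversion:
  assumes "\<And>d b. subseq [d, b] xs \<Longrightarrow> P b \<Longrightarrow> P d"
  shows "xs = filter P xs @ filter (\<lambda>x. \<not> P x) xs"
  using assms
proof (induction xs)
  case (Cons x xs)
  have IH: "xs = filter P xs @ filter (\<lambda>x. \<not> P x) xs"
    using Cons.prems by (intro Cons.IH) (meson list_emb_Cons)
  show ?case
  proof (cases "P x")
    case True
    then show ?thesis using IH by simp
  next
    case False
    have "\<not> P b" if "b \<in> set xs" for b
      using Cons.prems[of x b] that False by (auto simp: subseq_singleton_left)
    then have "filter P xs = []" by (auto simp: filter_empty_conv)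
    then show ?thesis using False IH by simp
  qed
qed simp

text \<open>One letter \<open>b\<close> of the block and the last letter \<open>s\<close> of
  \<open>D\<close> suffice. As the 1 of 1342, \<open>s\<close> gives the 231 condition; as the 4 and
  the 1 of 4123, \<open>b\<close> and \<open>s\<close> give the decreasing run. If \<open>D\<close>
  is empty, \<open>b\<close> is the 1 itself, since the values of \<open>R\<close> above
  \<open>b\<close> are those above \<open>p\<close>.\<close>

lemma valid_tail_if_av_both:
  assumes "av_both (B @ D @ M # R)" "b \<in> set B" "p < b" "b < M" "\<And>d. d \<in> set D \<Longrightarrow> d < p"
    and "\<And>r. r \<in> set R \<Longrightarrow> r < M \<and> (r \<le> p \<or> b < r)"
  shows "valid_tail (last (p # D)) p R"
proof -
  define s where "s = last (p # D)"
  have "av_both (M # R)"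
    using assms(1) by (rule av_both_subseq[rotated]) (simp add: list_emb_append2)
  moreover have "filter (\<lambda>y. y < M) R = R" using assms(6) by (auto simp: filter_id_conv)
  ultimately have 1: "av123 R" by simp
  have b: "subseq [b] B" using assms(2) by (simp add: subseq_singleton_left)
  show ?thesis
  proof (cases "D = []")
    case True
    have "subseq ([b] @ R) (B @ (D @ M # R))"
      using b by (intro list_emb_append_mono) (auto intro: list_emb_append2 list_emb_Cons)
    then have "av_both ([b] @ R)" using assms(1) by (rule av_both_subseq)
    then have "av231 (filter (\<lambda>y. b < y) R)" by simp
    also have "b < y \<longleftrightarrow> p < y" if "y \<in> set R" for y
      using assms(3) assms(6)[OF that] by linarith
    then have "filter (\<lambda>y. b < y) R = filter (\<lambda>y. p < y) R" by (intro filter_cong) auto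
    finally show ?thesis using 1 True by (simp add: valid_tail_def filter_False)
  next
    case False
    then have s: "s \<in> set D" "s = last D" by (auto simp: s_def)
    then have "subseq ([s] @ R) (D @ (M # R))"
      by (intro list_emb_append_mono) (auto simp: subseq_singleton_left)
    with b have "subseq ([b] @ ([s] @ R)) (B @ (D @ (M # R)))"
      by (rule list_emb_append_mono)
    then have "av_both ([b] @ [s] @ R)" using assms(1) by (rule av_both_subseq)
    moreover have "s < b" using assms(3,5) s by (meson less_trans)
    ultimately have "av231 (filter (\<lambda>y. s < y) R)" "dec (filter (\<lambda>y. y < b \<and> s < y) R)"
      by auto
    moreover from this(2) have "dec (filter (\<lambda>y. s < y \<and> y \<le> p) R)"
      by (rule dec_filter_mono) (use assms(3) in auto)
    ultimately show ?thesis using 1 False s(2) by (simp add: valid_tail_def)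
  qed
qed

lemma count_av_both_shift: "count_perms av_both {p<..p + m} = count_perms av_both {1..m}"
proof -
  let ?f = "\<lambda>x :: nat. x + p"
  have "{p<..p + m} = ?f ` {1..m}"
    by (simp add: image_add_atLeastAtMost' atLeastSucAtMost_greaterThanAtMost[symmetric] add.commute)
  moreover have "inj_on ?f {1..m}" by simp
  ultimately have "permutations_of_set {p<..p + m} = map ?f ` permutations_of_set {1..m}"
    by (simp only: permutations_of_set_image_inj)
  then have "{xs \<in> permutations_of_set {p<..p + m}. av_both xs} =
    map ?f ` {xs \<in> permutations_of_set {1..m}. av_both xs}"
    by (auto simp: av_both_shift)
  then show ?thesis unfolding count_perms_def by (simp add: card_image inj_on_def)
qed

section \<open>The bijection between words and triples (B, D, R)\<close>

definition glue :: "nat \<Rightarrow> nat list \<times> nat list \<times> nat list \<Rightarrow> nat list" where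
  "glue M = (\<lambda>(B, D, R). B @ D @ M # R)"

text \<open>Excluding \<open>p\<close> from D puts \<open>p\<close> into R unless
  \<open>p = 0\<close>; this is what lets the glued word determine \<open>m\<close> and
  \<open>p\<close>.\<close>

definition pieces :: "nat \<Rightarrow> nat \<Rightarrow> nat \<Rightarrow> (nat list \<times> nat list \<times> nat list) set" where
  "pieces N m p = {B \<in> permutations_of_set {p<..p + m}. av_both B} \<times>
     {(D, R) \<in> dec_pairs p p ({1..N} - {p<..p + m}). p \<notin> set D}"

lemma pieces_iff:
  "(B, D, R) \<in> pieces N m p \<longleftrightarrow>
     set B = {p<..p + m} \<and> distinct B \<and> av_both B \<and>
     distinct (D @ R) \<and> set (D @ R) = {1..N} - {p<..p + m} \<and> dec D \<and> (\<forall>d\<in>set D. d < p) \<and>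
     valid_tail (last (p # D)) p R"
  unfolding pieces_def dec_pairs_def permutations_of_set_def by (auto simp: order.strict_iff_order)

lemma card_pieces:
  assumes "p + m \<le> N"
  shows "real (card (pieces N m p)) =
    real (count_perms av_both {1..m}) * fps_nth (frame_fps (N - m - p)) p"
proof -
  let ?S = "{1..N} - {p<..p + m}"
  have 1: "{y \<in> ?S. p < y} = {p + m<..N}" and 2: "{y \<in> ?S. y \<le> p} = {1..p}"
    using assms by auto
  have "p \<in> ?S \<or> {y \<in> ?S. y \<le> p} = {}" unfolding 2 using assms by auto
  from card_dec_pairs_avoiding[OF _ this, unfolded 1 2]
  have "real (card {(D, R) \<in> dec_pairs p p ?S. p \<notin> set D}) = fps_nth (frame_fps (N - m - p)) p"
    by (simp add: diff_diff_left add.commute)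
  moreover have "card {B \<in> permutations_of_set {p<..p + m}. av_both B} = count_perms av_both {1..m}"
    using count_av_both_shift by (simp add: count_perms_def)
  ultimately show ?thesis by (simp add: pieces_def card_cartesian_product)
qed

lemma finite_pieces: "finite (pieces N m p)"
proof -
  have "finite {(D, R) \<in> dec_pairs p p ({1..N} - {p<..p + m}). p \<notin> set D}"
    by (rule finite_subset[OF _ finite_dec_pairs]) auto
  then show ?thesis unfolding pieces_def by (intro finite_cartesian_product) simp_all
qed

lemma glue_pieces_props:
  assumes "x \<in> pieces N m p" "m \<ge> 1" "p + m \<le> N"
  shows "set (glue (Suc N) x) = {1..Suc N}" "distinct (glue (Suc N) x)" "av_both (glue (Suc N) x)"
    "hd (glue (Suc N) x) \<noteq> Suc N"
proof -
  obtain B D R where x: "x = (B, D, R)" by (cases x) auto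
  note BDR = assms(1)[unfolded x pieces_iff]
  have sets: "set B = {p<..p + m}" "set D \<union> set R = {1..N} - {p<..p + m}" using BDR by auto
  have "set (glue (Suc N) x) = insert (Suc N) (set B \<union> (set D \<union> set R))"
    by (auto simp: x glue_def)
  also have "set B \<union> (set D \<union> set R) = {1..N}" unfolding sets using assms(3) by auto
  finally show "set (glue (Suc N) x) = {1..Suc N}" by (simp add: atLeastAtMostSuc_conv)
  have D: "set D \<subseteq> {1..N} - {p<..p + m}" and R: "set R \<subseteq> {1..N} - {p<..p + m}" using sets(2) by auto
  show "distinct (glue (Suc N) x)"
    unfolding x glue_def using BDR D R assms(3) by auto
  have Rr: "r < Suc N \<and> (r \<le> p \<or> (\<forall>b\<in>set B. b < r))" if "r \<in> set R" for r
    using that R sets(1) by force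
  show "av_both (glue (Suc N) x)"
    unfolding x glue_def prod.case using BDR Rr assms by (intro av_both_construct) auto
  have "B \<noteq> []" using sets(1) assms(2) by auto
  then have "hd B \<in> {p<..p + m}" using sets(1) by (metis hd_in_set)
  then show "hd (glue (Suc N) x) \<noteq> Suc N"
    using \<open>B \<noteq> []\<close> assms(3) unfolding x glue_def by auto
qed

text \<open>\<open>p + m\<close> is the largest letter before the maximum, and a positive
  \<open>p\<close> is the largest value after the maximum that is less than \<open>p + m\<close>.
  Inequalities are enough, since the two triples can be exchanged.\<close>

lemma glue_pieces_eqD:
  assumes "(B, D, R) \<in> pieces N m p" "m \<ge> 1" "p + m \<le> N"
    and "(B', D', R') \<in> pieces N m' p'" "m' \<ge> 1" "p' + m' \<le> N"
    and "glue (Suc N) (B, D, R) = glue (Suc N) (B', D', R')"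
  shows "B @ D = B' @ D'" "R = R'" "p + m \<le> p' + m'" "p' + m' \<le> p + m \<Longrightarrow> p' \<le> p"
proof -
  note BDR = assms(1)[unfolded pieces_iff] and BDR' = assms(4)[unfolded pieces_iff]
  have sets: "set B = {p<..p + m}" "set D \<subseteq> {1..N}" "set R \<subseteq> {1..N} - {p<..p + m}" using BDR by auto
  have sets': "set B' = {p'<..p' + m'}" "\<And>d. d \<in> set D' \<Longrightarrow> d < p'" using BDR' by auto
  have "Suc N \<notin> set (B @ D)" "Suc N \<notin> set R" using sets assms(3) by auto
  moreover have "(B @ D) @ Suc N # R = (B' @ D') @ Suc N # R'"
    using assms(7) by (simp add: glue_def)
  ultimately have "B @ D = B' @ D' \<and> R = R'"
    using append_Cons_eq_iff[of "Suc N" "B @ D" R "B' @ D'" R'] by blast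
  then show BD: "B @ D = B' @ D'" and R: "R = R'" by blast+
  have "p + m \<in> set (B @ D)" using sets(1) assms(2) by simp
  then show "p + m \<le> p' + m'" unfolding BD using sets' by fastforce
  show "p' \<le> p" if "p' + m' \<le> p + m"
  proof (rule ccontr)
    assume "\<not> p' \<le> p"
    then have "p' \<in> {1..N} - {p'<..p' + m'}" "p' \<in> {p<..p + m}"
      using assms(6) that by auto
    moreover have "set (D' @ R') = {1..N} - {p'<..p' + m'}" using BDR' by blast
    ultimately have "p' \<in> set (D' @ R')" by blast
    then have "p' \<in> set R" using sets'(2)[of p'] R by auto
    then show False using sets(3) \<open>p' \<in> {p<..p + m}\<close> by blast
  qed
qed

lemma glue_pieces_inj:
  assumes "x \<in> pieces N m p" "m \<ge> 1" "p + m \<le> N" "x' \<in> pieces N m' p'" "m' \<ge> 1" "p' + m' \<le> N"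
    and "glue (Suc N) x = glue (Suc N) x'"
  shows "m = m' \<and> p = p' \<and> x = x'"
proof -
  obtain B D R B' D' R' where x: "x = (B, D, R)" "x' = (B', D', R')" by (cases x; cases x') auto
  note 1 = glue_pieces_eqD[OF assms(1-6)[unfolded x] assms(7)[unfolded x]]
  note 2 = glue_pieces_eqD[OF assms(4-6)[unfolded x] assms(1-3)[unfolded x] assms(7)[unfolded x, symmetric]]
  have mp: "m = m'" "p = p'" using 1(3,4) 2(3,4) by auto
  have "set B = {p<..p + m}" "distinct B" "set B' = {p<..p + m}" "distinct B'"
    using assms(1,4) unfolding x mp pieces_iff by blast+
  then have "length B = length B'" by (metis distinct_card)
  then show ?thesis using 1(1,2) mp x by simp
qed

lemma glue_pieces_surj:
  assumes "set xs = {1..Suc N}" "distinct xs" "av_both xs" "hd xs \<noteq> Suc N"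
  obtains m p x where "m \<ge> 1" "p + m \<le> N" "x \<in> pieces N m p" "xs = glue (Suc N) x"
proof -
  have "Suc N \<in> set xs" using assms(1) by simp
  then obtain L R where xs: "xs = L @ Suc N # R" by (auto simp: in_set_conv_decomp)
  have "L \<noteq> []" using assms(4) xs by auto
  have LR: "set L \<union> set R = {1..N}" "distinct L" "distinct R" "set L \<inter> set R = {}"
  proof -
    have "Suc N \<notin> set L" "Suc N \<notin> set R" using assms(2) xs by auto
    then have "set L \<union> set R = {1..Suc N} - {Suc N}" using assms(1) xs by auto
    also have "\<dots> = {1..N}" by auto
    finally show "set L \<union> set R = {1..N}" .
  qed (use assms(2) xs in auto)
  have LR_mem: "x \<in> set L \<or> x \<in> set R \<longleftrightarrow> 1 \<le> x \<and> x \<le> N" for x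
    using LR(1) by (metis Un_iff atLeastAtMost_iff)
  define h where "h = Max (set L)"
  have h: "h \<in> set L" "\<And>x. x \<in> set L \<Longrightarrow> x \<le> h" using \<open>L \<noteq> []\<close> by (simp_all add: h_def)
  have "h \<in> {1..N}" using h(1) LR(1) by blast
  \<comment> \<open>The value 0 stands in when R has nothing below \<open>h\<close>; no letter can
    then lie below \<open>p\<close>, so D is empty.\<close>
  define p where "p = Max (insert 0 {r \<in> set R. r < h})"
  have "p \<in> insert 0 {r \<in> set R. r < h}" unfolding p_def by (intro Max_in) auto
  then have p: "p = 0 \<or> p \<in> set R" "p < h" using \<open>h \<in> {1..N}\<close> by auto
  have p_max: "r \<le> p" if "r \<in> set R" "r < h" for r
    unfolding p_def using that by (intro Max_ge) auto
  have "p \<notin> set L" using p(1) LR(4) LR_mem[of p] by auto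
  define B D where "B = filter (\<lambda>x. p < x) L" and "D = filter (\<lambda>x. \<not> p < x) L"
  have D: "d < p" "p \<in> set R" if "d \<in> set D" for d
  proof -
    have "d \<in> set L" "d \<le> p" using that by (auto simp: D_def)
    then show "d < p" using \<open>p \<notin> set L\<close> by (metis le_neq_implies_less)
    then show "p \<in> set R" using p(1) by simp
  qed
  have forbidden: "\<not> (b < c \<and> c < d \<and> d < a)" "\<not> (a < d \<and> d < b \<and> b < c)"
    if "subseq [a, b, c, d] xs" for a b c d
    using assms(3) that unfolding av_both_iff_subseq by blast+
  have L: "L = B @ D"
    unfolding B_def D_def
  proof (rule filter_append_if_no_inversion, rule ccontr)
    fix d b assume db: "subseq [d, b] L" "p < b" "\<not> p < d"
    then have "b \<in> set L" "d \<in> set L" using subseq_pairD[OF db(1)] by auto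
    then have "d \<in> set D" using db(3) by (simp add: D_def)
    then have "d < p" "p \<in> set R" by (rule D)+
    \<comment> \<open>With \<open>d < p < b\<close> this is a copy of 1342.\<close>
    have "subseq ([d, b] @ ([Suc N] @ [p])) (L @ ([Suc N] @ R))"
      using db(1) \<open>p \<in> set R\<close> by (intro list_emb_append_mono) (simp_all add: subseq_singleton_left)
    then have "subseq [d, b, Suc N, p] xs" by (simp add: xs)
    moreover have "b < Suc N" using \<open>b \<in> set L\<close> LR_mem[of b] by simp
    ultimately show False using forbidden(2) \<open>d < p\<close> db(2) by blast
  qed
  have "h \<in> set B" using h p(2) by (simp add: B_def)
  have "dec D"
    unfolding dec_iff_subseq
  proof (intro allI impI notI)
    fix a b assume ab: "subseq [a, b] D" "a < b"
    then have "b \<in> set D" using subseq_pairD[OF ab(1)] by auto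
    then have "b < p" "p \<in> set R" by (rule D)+
    \<comment> \<open>With \<open>a < b < p < h\<close> this is a copy of 4123; the order of
      \<open>B\<close> and \<open>D\<close> puts \<open>h\<close> in front.\<close>
    have "subseq ([h] @ ([a, b] @ [p])) (B @ (D @ (Suc N # R)))"
      using ab(1) \<open>p \<in> set R\<close> \<open>h \<in> set B\<close>
      by (intro list_emb_append_mono) (simp_all add: subseq_singleton_left)
    then have "subseq [h, a, b, p] xs" by (simp add: xs L)
    then show False using forbidden(1) ab(2) \<open>b < p\<close> p(2) by blast
  qed
  have B_set: "set B = {p<..p + (h - p)}"
  proof -
    have "x \<in> set L" if "p < x" "x \<le> h" for x
    proof (rule ccontr)
      assume "x \<notin> set L"
      then have "x \<noteq> h" using h(1) by blast
      then have "x < h" using that(2) by simp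
      moreover have "x \<in> set R" using LR_mem[of x] \<open>x \<notin> set L\<close> that \<open>h \<in> {1..N}\<close> by simp
      ultimately show False using p_max[of x] that(1) by simp
    qed
    then have "set B = {p<..h}" using h(2) by (auto simp: B_def)
    then show ?thesis using p(2) by simp
  qed
  have "valid_tail (last (p # D)) p R"
  proof (rule valid_tail_if_av_both)
    show "av_both (B @ D @ Suc N # R)" using assms(3) by (simp add: xs L)
    show "r < Suc N \<and> (r \<le> p \<or> h < r)" if "r \<in> set R" for r
    proof -
      have "r \<noteq> h" "r \<le> N" using that h(1) LR(4) LR_mem[of r] by auto
      then show ?thesis using p_max[OF that] by linarith
    qed
  qed (use \<open>h \<in> set B\<close> p(2) \<open>h \<in> {1..N}\<close> D in auto)
  moreover have "av_both B"
    using assms(3) by (rule av_both_subseq[rotated]) (auto simp: xs L intro!: prefix_imp_subseq)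
  moreover have "set L = set B \<union> set D" using arg_cong[OF L, of set] by simp
  moreover have "distinct (B @ D)" using LR(2) L by simp
  ultimately have "distinct B" "distinct (D @ R)" "set (D @ R) = (set L \<union> set R) - set B"
    "av_both B" "valid_tail (last (p # D)) p R"
    using LR(3,4) by auto
  then have "(B, D, R) \<in> pieces N (h - p) p"
    unfolding pieces_iff LR(1) B_set using \<open>dec D\<close> D(1) by blast
  moreover have "xs = glue (Suc N) (B, D, R)" by (simp add: glue_def xs L)
  ultimately show ?thesis using p(2) \<open>h \<in> {1..N}\<close> by (intro that[of "h - p" p]) auto
qed

text \<open>If the maximum comes first, the rest is any 123-avoiding word. Otherwise the word is
  glued from pieces, and \<open>u = N - m - p\<close> is the number of values above the
  block.\<close>

lemma count_av_both_Suc: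
  "real (count_perms av_both {1..Suc N}) = fps_nth catalan_fps N +
    (\<Sum>m=1..N. real (count_perms av_both {1..m}) * (\<Sum>u\<le>N - m. fps_nth (frame_fps u) (N - m - u)))"
proof -
  define I where "I = (SIGMA m:{1..N}. {..N - m})"
  define A where "A = (\<lambda>(m, p). pieces N m p)"
  have I: "m \<ge> 1" "p + m \<le> N" if "(m, p) \<in> I" for m p using that by (auto simp: I_def)
  have "finite I" by (simp add: I_def)
  let ?G = "(#) (Suc N) ` {R \<in> permutations_of_set {1..N}. av123 R}"
  let ?H = "glue (Suc N) ` (\<Union>i\<in>I. A i)"
  have G: "av_both (Suc N # R) \<longleftrightarrow> av123 R" if "set R = {1..N}" for R
    using that by (intro av_both_max_Cons) auto
  have "{xs \<in> permutations_of_set {1..Suc N}. av_both xs} = ?G \<union> ?H" (is "?P = _")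
  proof (intro equalityI subsetI)
    fix xs assume xs: "xs \<in> ?P"
    show "xs \<in> ?G \<union> ?H"
    proof (cases "hd xs = Suc N")
      case True
      then obtain R where R: "xs = Suc N # R"
        using xs by (cases xs) (auto simp: permutations_of_set_def)
      then have "insert (Suc N) (set R) = {1..Suc N}" "Suc N \<notin> set R" "distinct R"
        using xs by (auto simp: permutations_of_set_def)
      then have "set R = {1..Suc N} - {Suc N}" by blast
      also have "\<dots> = {1..N}" by auto
      finally show ?thesis using xs G[of R] \<open>distinct R\<close> unfolding R by (auto simp: permutations_of_set_def)
    next
      case False
      have "set xs = {1..Suc N}" "distinct xs" "av_both xs"
        using xs by (auto simp: permutations_of_set_def)
      from glue_pieces_surj[OF this False] obtain m p x
        where "m \<ge> 1" "p + m \<le> N" "x \<in> pieces N m p" "xs = glue (Suc N) x" .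
      then have "(m, p) \<in> I" "x \<in> A (m, p)" by (auto simp: I_def A_def)
      then show ?thesis using \<open>xs = _\<close> by blast
    qed
  next
    fix xs assume "xs \<in> ?G \<union> ?H"
    then show "xs \<in> ?P"
    proof
      assume "xs \<in> ?G"
      then obtain R where R: "xs = Suc N # R" "set R = {1..N}" "distinct R" "av123 R"
        by (auto simp: permutations_of_set_def)
      then show ?thesis using G[of R] by (auto simp: permutations_of_set_def simp del: av_both.simps)
    next
      assume "xs \<in> ?H"
      then obtain m p x where "(m, p) \<in> I" "x \<in> pieces N m p" "xs = glue (Suc N) x"
        by (auto simp: A_def)
      then show ?thesis using glue_pieces_props[of x N m p] I[of m p] by (simp add: permutations_of_set_def)
    qed
  qed
  moreover have hd_glue: "hd xs \<noteq> Suc N" if "xs \<in> ?H" for xs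
    using that I glue_pieces_props(4) by (fastforce simp: A_def)
  have "hd xs = Suc N" if "xs \<in> ?G" for xs using that by auto
  with hd_glue have "?G \<inter> ?H = {}" by blast
  moreover have fin: "finite (\<Union>i\<in>I. A i)"
    using \<open>finite I\<close> by (auto simp: A_def finite_pieces)
  ultimately have "count_perms av_both {1..Suc N} = card ?G + card ?H"
    unfolding count_perms_def by (simp add: card_Un_disjoint)
  moreover have "card ?H = (\<Sum>i\<in>I. card (A i))"
  proof -
    have inj: "i = j \<and> x = y" if "i \<in> I" "j \<in> I" "x \<in> A i" "y \<in> A j" "glue (Suc N) x = glue (Suc N) y" for i j x y
      using that I glue_pieces_inj[of x N "fst i" "snd i" y "fst j" "snd j"]
      by (cases i; cases j) (auto simp: A_def)
    have "inj_on (glue (Suc N)) (\<Union>i\<in>I. A i)"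
      by (rule inj_onI) (use inj in blast)
    then have "card ?H = card (\<Union>i\<in>I. A i)" by (rule card_image)
    also have "\<dots> = (\<Sum>i\<in>I. card (A i))"
      using \<open>finite I\<close> inj by (intro card_UN_disjoint) (auto simp: A_def finite_pieces)
    finally show ?thesis .
  qed
  moreover have "(\<Sum>i\<in>I. real (card (A i))) =
    (\<Sum>m=1..N. real (count_perms av_both {1..m}) * (\<Sum>u\<le>N - m. fps_nth (frame_fps u) (N - m - u)))"
  proof -
    have "(\<Sum>i\<in>I. real (card (A i))) = (\<Sum>(m, p)\<in>I. real (count_perms av_both {1..m}) * fps_nth (frame_fps (N - m - p)) p)"
      using I by (intro sum.cong) (auto simp: A_def card_pieces)
    also have "\<dots> = (\<Sum>m=1..N. \<Sum>p\<le>N - m. real (count_perms av_both {1..m}) * fps_nth (frame_fps (N - m - p)) p)"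
      unfolding I_def by (subst sum.Sigma) auto
    also have "\<dots> = (\<Sum>m=1..N. \<Sum>u\<le>N - m. real (count_perms av_both {1..m}) * fps_nth (frame_fps u) (N - m - u))"
    proof (rule sum.cong[OF refl])
      fix m
      show "(\<Sum>p\<le>N - m. real (count_perms av_both {1..m}) * fps_nth (frame_fps (N - m - p)) p) =
        (\<Sum>u\<le>N - m. real (count_perms av_both {1..m}) * fps_nth (frame_fps u) (N - m - u))"
        by (rule sum.reindex_bij_witness[of _ "\<lambda>u. N - m - u" "\<lambda>p. N - m - p"]) (auto simp del: diff_diff_left)
    qed
    finally show ?thesis by (simp add: sum_distrib_left)
  qed
  moreover have "real (card ?G) = fps_nth catalan_fps N"
  proof -
    have "av123 R \<longleftrightarrow> av123_dec_above N R" if "set R = {1..N}" for R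
    proof -
      have "filter (\<lambda>y. N < y) R = []" using that by (auto simp: filter_empty_conv)
      then show ?thesis by (simp add: av123_dec_above_def)
    qed
    then have "count_perms av123 {1..N} = count_perms (av123_dec_above N) {1..N}"
      by (intro count_perms_cong) auto
    moreover have 1: "{y \<in> {1..N}. N < y} = {}" and 2: "{y \<in> {1..N}. y \<le> N} = {1..N}" by auto
    have "real (count_perms (av123_dec_above N) {1..N}) = fps_nth catalan_fps N"
      using count_av123_dec_above[of "{1..N}" N, unfolded 1 2] by simp
    ultimately show ?thesis by (simp add: count_perms_def card_image)
  qed
  ultimately show ?thesis by simp
qed

subsection \<open>Solving for the generating function\<close>

text \<open>The formal sum of all \<open>z ^ u * F u\<close>.\<close>

definition diag_fps :: "(nat \<Rightarrow> real fps) \<Rightarrow> real fps" where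
  "diag_fps F = Abs_fps (\<lambda>n. \<Sum>u\<le>n. fps_nth (F u) (n - u))"

lemma diag_fps_nth: "n \<le> N \<Longrightarrow> fps_nth (diag_fps F) n = fps_nth (\<Sum>u\<le>N. fps_X ^ u * F u) n"
proof -
  assume "n \<le> N"
  have "fps_nth (\<Sum>u\<le>N. fps_X ^ u * F u) n = (\<Sum>u\<le>N. if n < u then 0 else fps_nth (F u) (n - u))"
    by (simp add: fps_sum_nth fps_X_power_mult_nth)
  also have "\<dots> = (\<Sum>u\<le>n. if n < u then 0 else fps_nth (F u) (n - u))"
    using \<open>n \<le> N\<close> by (intro sum.mono_neutral_right) auto
  also have "\<dots> = (\<Sum>u\<le>n. fps_nth (F u) (n - u))"
    by (intro sum.cong) auto
  finally show ?thesis by (simp add: diag_fps_def)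
qed

lemma diag_fps_add: "diag_fps (\<lambda>u. F u + G u) = diag_fps F + diag_fps G"
  by (rule fps_ext) (simp add: diag_fps_def sum.distrib)

lemma diag_fps_cmult: "diag_fps (\<lambda>u. c * F u) = c * diag_fps F"
proof (rule fps_ext)
  fix n
  have "fps_nth (c * diag_fps F) n = (\<Sum>i=0..n. fps_nth c i * fps_nth (\<Sum>u\<le>n. fps_X ^ u * F u) (n - i))"
    unfolding fps_mult_nth by (intro sum.cong refl) (simp add: diag_fps_nth[of _ n])
  also have "\<dots> = fps_nth (c * (\<Sum>u\<le>n. fps_X ^ u * F u)) n"
    by (simp add: fps_mult_nth)
  also have "c * (\<Sum>u\<le>n. fps_X ^ u * F u) = (\<Sum>u\<le>n. fps_X ^ u * (c * F u))"
    by (simp add: sum_distrib_left mult_ac)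
  finally show "fps_nth (diag_fps (\<lambda>u. c * F u)) n = fps_nth (c * diag_fps F) n"
    by (simp add: diag_fps_nth[of n n])
qed

lemma diag_fps_shift: "diag_fps F = F 0 + fps_X * diag_fps (\<lambda>u. F (Suc u))"
proof (rule fps_ext)
  fix n show "fps_nth (diag_fps F) n = fps_nth (F 0 + fps_X * diag_fps (\<lambda>u. F (Suc u))) n"
    by (cases n) (simp_all add: diag_fps_def sum.atMost_Suc_shift del: sum.atMost_Suc)
qed

text \<open>A geometric series with value C^k / (1 - z C), where 1 / (1 - z C) = C is the Catalan
  equation.\<close>

lemma diag_catalan_fps_powers: "diag_fps (\<lambda>u. catalan_fps ^ (u + k)) = catalan_fps ^ Suc k"
proof -
  let ?D = "diag_fps (\<lambda>u. catalan_fps ^ u)"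
  have "?D = 1 + fps_X * (catalan_fps * ?D)"
    by (subst diag_fps_shift) (simp add: diag_fps_cmult)
  moreover have "catalan_fps = 1 + fps_X * (catalan_fps * catalan_fps)"
    using catalan_fps_rec by (simp add: power2_eq_square)
  ultimately have "(1 - fps_X * catalan_fps) * (?D - catalan_fps) = 0" by algebra
  moreover have "fps_nth (1 - fps_X * catalan_fps) 0 \<noteq> 0" by simp
  then have "1 - fps_X * catalan_fps \<noteq> 0" by (metis fps_zero_nth)
  ultimately have "?D = catalan_fps" by simp
  then show ?thesis
    using diag_fps_cmult[of "catalan_fps ^ k" "\<lambda>u. catalan_fps ^ u"]
    by (simp add: power_add mult.commute)
qed

text \<open>Each of the two nested sums in \<open>catalan_tri\<close> amounts to a factor z / (1 -
  z), applied to the diagonal sum C^3 of the powers C^(w+2). The index shift removes one z.\<close>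

lemma diag_catalan_tri:
  "(1 - fps_X)\<^sup>2 * diag_fps catalan_tri = fps_X\<^sup>2 * catalan_fps ^ 3"
  "(1 - fps_X)\<^sup>2 * diag_fps (\<lambda>u. catalan_tri (Suc u)) = fps_X * catalan_fps ^ 3"
proof -
  let ?E = "diag_fps (\<lambda>u. \<Sum>w<u. catalan_fps ^ (w + 2))"
  have "?E = fps_X * (?E + catalan_fps ^ 3)"
  proof -
    have "?E = fps_X * diag_fps (\<lambda>u. (\<Sum>w<u. catalan_fps ^ (w + 2)) + catalan_fps ^ (u + 2))"
      by (subst diag_fps_shift) simp
    also have "\<dots> = fps_X * (?E + catalan_fps ^ Suc 2)"
      by (simp only: diag_fps_add diag_catalan_fps_powers)
    finally show ?thesis by (simp add: eval_nat_numeral)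
  qed
  moreover have *: "diag_fps (\<lambda>u. catalan_tri (Suc u)) = diag_fps catalan_tri + ?E"
    by (simp add: catalan_tri_Suc diag_fps_add)
  moreover have "diag_fps catalan_tri = fps_X * diag_fps (\<lambda>u. catalan_tri (Suc u))"
    by (subst diag_fps_shift) (simp add: catalan_tri_def)
  ultimately show "(1 - fps_X)\<^sup>2 * diag_fps catalan_tri = fps_X\<^sup>2 * catalan_fps ^ 3"
    "(1 - fps_X)\<^sup>2 * diag_fps (\<lambda>u. catalan_tri (Suc u)) = fps_X * catalan_fps ^ 3"
    by algebra+
qed

lemma diag_frame_fps:
  "(1 - 2 * fps_X) * (1 - fps_X) * diag_fps frame_fps =
     (1 - 2 * fps_X) * (1 - fps_X) * (catalan_fps\<^sup>2 + fps_X\<^sup>2 * catalan_fps ^ 5) +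
     fps_X\<^sup>2 * catalan_fps ^ 3"
proof -
  define i :: "real fps" where "i = inverse (1 - 2 * fps_X)"
  have i: "(1 - 2 * fps_X) * i = 1"
    unfolding i_def by (subst mult.commute, rule inverse_mult_eq_1) simp
  have "diag_fps frame_fps = catalan_fps\<^sup>2 + diag_fps catalan_tri +
      fps_X\<^sup>2 * (catalan_fps ^ 5 + i * diag_fps (\<lambda>u. catalan_tri (Suc u)))"
  proof -
    have "frame_fps = (\<lambda>u. catalan_fps ^ (u + 1) + catalan_tri u +
        fps_X\<^sup>2 * (catalan_fps ^ (u + 4) + i * catalan_tri (Suc u)))"
      by (simp add: fun_eq_iff frame_fps_def pair_corr_def i_def mult.commute)
    then have "diag_fps frame_fps = diag_fps (\<lambda>u. catalan_fps ^ (u + 1) + catalan_tri u +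
        fps_X\<^sup>2 * (catalan_fps ^ (u + 4) + i * catalan_tri (Suc u)))"
      by (rule arg_cong)
    also have "\<dots> = catalan_fps ^ Suc 1 + diag_fps catalan_tri +
      fps_X\<^sup>2 * (catalan_fps ^ Suc 4 + i * diag_fps (\<lambda>u. catalan_tri (Suc u)))"
      by (simp only: diag_fps_add diag_fps_cmult diag_catalan_fps_powers)
    finally show ?thesis by (simp add: eval_nat_numeral)
  qed
  \<comment> \<open>The two triangular contributions combine by 1 + z / (1 - 2z) = (1 - z) / (1 -
    2z), which removes one factor of the denominator (1 - z)^2. That factor is kept here and
    cancelled afterwards.\<close>
  then have "(1 - fps_X) * ((1 - 2 * fps_X) * (1 - fps_X) * diag_fps frame_fps) =
    (1 - fps_X) * ((1 - 2 * fps_X) * (1 - fps_X) * (catalan_fps\<^sup>2 + fps_X\<^sup>2 * catalan_fps ^ 5) +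
     fps_X\<^sup>2 * catalan_fps ^ 3)"
    using i diag_catalan_tri by algebra
  moreover have "fps_nth (1 - fps_X :: real fps) 0 \<noteq> 0" by simp
  then have "(1 - fps_X :: real fps) \<noteq> 0" by (metis fps_zero_nth)
  ultimately show ?thesis by simp
qed

lemma class_gf_solution:
  fixes P :: "real fps"
  assumes P: "P = fps_X * (catalan_fps + P * diag_fps frame_fps)"
  defines "z \<equiv> fps_X"
  shows "P = (z * (1 - z) * (1 - 2 * z) *
       (1 - 7 * z + 17 * z ^ 2 - 16 * z ^ 3 + 4 * z ^ 4
        + (1 - 3 * z + 3 * z ^ 2) * fps_sqrt (1 - 4 * z)))
    / (2 - 22 * z + 96 * z ^ 2 - 220 * z ^ 3 + 282 * z ^ 4
       - 196 * z ^ 5 + 64 * z ^ 6 - 8 * z ^ 7)"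
proof -
  define c where "c = catalan_fps"
  define q where "q = (1 - 2 * z) * (1 - z)"
  define A where "A = 1 - 7 * z + 17 * z ^ 2 - 16 * z ^ 3 + 4 * z ^ 4
        + (1 - 3 * z + 3 * z ^ 2) * (1 - 2 * z * c)"
  define d where "d = 2 - 22 * z + 96 * z ^ 2 - 220 * z ^ 3 + 282 * z ^ 4
       - 196 * z ^ 5 + 64 * z ^ 6 - 8 * z ^ 7"
  \<comment> \<open>This is q (1 - z G) with the denominators of G cleared, the coefficient of P in
    the linear equation.\<close>
  define W where "W = q - z * q * (c\<^sup>2 + z\<^sup>2 * c ^ 5) - z ^ 3 * c ^ 3"
  have c: "c = 1 + z * c\<^sup>2" unfolding c_def z_def by (rule catalan_fps_rec)
  have PW: "P * W = z * q * c"
  proof -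
    have "q * diag_fps frame_fps = q * (c\<^sup>2 + z\<^sup>2 * c ^ 5) + z\<^sup>2 * c ^ 3"
      unfolding q_def c_def z_def by (rule diag_frame_fps)
    moreover have "P = z * (c + P * diag_fps frame_fps)"
      using P by (simp add: c_def z_def)
    ultimately show ?thesis unfolding W_def by algebra
  qed
  \<comment> \<open>The factor A clears the square root from W / c, leaving the polynomial d; the
    identity follows from c = 1 + z c^2 alone.\<close>
  have AW: "A * W = c * d"
    using c unfolding A_def W_def d_def q_def by algebra
  have "fps_nth W 0 = 1" by (simp add: W_def q_def z_def)
  then have "W \<noteq> 0" by auto
  have "(P * d) * W = (z * q * A) * W" using PW AW by algebra
  then have "P * d = z * q * A" using \<open>W \<noteq> 0\<close> by simp
  moreover have "fps_nth d 0 = 2" by (simp add: d_def z_def)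
  then have "d \<noteq> 0" by auto
  ultimately have "P = (z * q * A) / d" by (metis nonzero_mult_div_cancel_right)
  moreover have "fps_sqrt (1 - 4 * z) = 1 - 2 * z * c"
    unfolding z_def c_def by (rule fps_sqrt_eq_catalan)
  ultimately show ?thesis by (simp add: q_def A_def d_def mult_ac)
qed

theorem theorem1p3:
  fixes z :: "real fps"
  defines "z \<equiv> fps_X"
  shows "P3 = 1 +
    (z * (1 - z) * (1 - 2 * z) *
       (1 - 7 * z + 17 * z ^ 2 - 16 * z ^ 3 + 4 * z ^ 4
        + (1 - 3 * z + 3 * z ^ 2) * fps_sqrt (1 - 4 * z)))
    / (2 - 22 * z + 96 * z ^ 2 - 220 * z ^ 3 + 282 * z ^ 4
       - 196 * z ^ 5 + 64 * z ^ 6 - 8 * z ^ 7)"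
proof -
  \<comment> \<open>The block B is never empty, so the recursion runs over nonempty members only;
    subtracting 1 removes the empty permutation.\<close>
  define P where "P = P3 - 1"
  have P3_nth: "fps_nth P3 n = real (count_perms av_both {1..n})" for n
    unfolding P3_def class_gf_def perms_Int_Av count_perms_def by simp
  have P0: "fps_nth P 0 = 0"
    by (simp add: P_def P3_nth count_perms_empty)
  have P_pos: "fps_nth P m = real (count_perms av_both {1..m})" if "m \<ge> 1" for m
    using that by (simp add: P_def P3_nth)
  have "P = fps_X * (catalan_fps + P * diag_fps frame_fps)"
  proof (rule fps_ext)
    fix n
    show "fps_nth P n = fps_nth (fps_X * (catalan_fps + P * diag_fps frame_fps)) n"
    proof (cases n)
      case 0
      then show ?thesis using P0 by simp
    next
      case (Suc N)
      have "fps_nth (P * diag_fps frame_fps) N =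
          (\<Sum>m=1..N. fps_nth P m * fps_nth (diag_fps frame_fps) (N - m))"
        unfolding fps_mult_nth by (subst sum.atLeast_Suc_atMost) (simp_all add: P0)
      also have "\<dots> = (\<Sum>m=1..N. real (count_perms av_both {1..m}) *
          (\<Sum>u\<le>N - m. fps_nth (frame_fps u) (N - m - u)))"
        by (intro sum.cong refl) (simp add: P_pos diag_fps_def)
      finally have "fps_nth catalan_fps N + fps_nth (P * diag_fps frame_fps) N = fps_nth P (Suc N)"
        using count_av_both_Suc[of N] P_pos[of "Suc N"] by simp
      then show ?thesis unfolding Suc by simp
    qed
  qed
  from class_gf_solution[OF this] show ?thesis
    unfolding z_def P_def by (simp add: diff_eq_eq add.commute)
qed

end
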